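(* Let $n\ge2$ and $s\in(0,1)$. For any $\varepsilon>0$ there exist a non-trivial (non-constant) solution $u$ and an obstacle $\varphi\in C^\infty(\mathbb R^n)$ such that $$\begin{cases} (-\Delta)^s u\ge0 & \text{in }\mathbb R^n, \\ (-\Delta)^s u=0 & \text{in }\{u>\varphi\}, \\ {u}\ge\varphi & \text{in }\mathbb R^n, \end{cases}$$ and the boundary of the contact set $\Lambda(u)=\{u=\varphi\}$ fulfils $$\dim_{\mathcal H}\partial\Lambda(u)\ge n-\varepsilon.$$
   Context: $(-\Delta)^s$ is the fractional Laplacian in $\mathbb R^n$; $\partial\Lambda(u)$ is the topological boundary in $\mathbb R^n$; $\dim_{\mathcal H}$ is Hausdorff dimension. *)

theory Defs
  imports "HOL-Analysis.Analysis"
begin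

primrec C_k :: "nat \<Rightarrow> ('a::real_normed_vector \<Rightarrow> 'b::real_normed_vector) \<Rightarrow> bool" where
  "C_k 0 f \<longleftrightarrow> continuous_on UNIV f"
| "C_k (Suc k) f \<longleftrightarrow>
     (\<forall>x. f differentiable (at x)) \<and> (\<forall>v. C_k k (\<lambda>x. frechet_derivative f (at x) v))"

definition C_infinity :: "('a::real_normed_vector \<Rightarrow> 'b::real_normed_vector) \<Rightarrow> bool" where
  "C_infinity f \<longleftrightarrow> (\<forall>k. C_k k f)"

text \<open>The usual normalisation, for which the Fourier symbol of \<open>(-\<Delta>)\<^sup>s\<close> is
  \<open>\<bar>\<xi>\<bar>\<close> to the power \<open>2s\<close>.\<close>

definition frac_laplacian_const :: "nat \<Rightarrow> real \<Rightarrow> real" where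
  "frac_laplacian_const n s =
     4 powr s * Gamma (real n / 2 + s) / (pi powr (real n / 2) * \<bar>Gamma (- s)\<bar>)"

text \<open>\<open>(-\<Delta>)\<^sup>s u (x)\<close> exists in the pointwise sense and equals \<open>L\<close>: the principal value
  integral converges to the finite number \<open>L\<close>. The weighted integrability condition
  ensures that, for each \<open>r > 0\<close>, the truncated integral is an honest Lebesgue
  integral (and not the default value 0 of a non-integrable function).\<close>

definition has_frac_laplacian ::
    "real \<Rightarrow> ('a::euclidean_space \<Rightarrow> real) \<Rightarrow> real \<Rightarrow> 'a \<Rightarrow> bool" where
  "has_frac_laplacian s u L x \<longleftrightarrow>
     integrable lborel (\<lambda>y. u y / (1 + norm y) powr (real DIM('a) + 2 * s)) \<and>
     ((\<lambda>r. frac_laplacian_const DIM('a) s *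
            (LINT y:{y. r < dist x y}|lborel.
               (u x - u y) / norm (x - y) powr (real DIM('a) + 2 * s)))
        \<longlongrightarrow> L) (at_right 0)"

definition frac_laplacian :: "real \<Rightarrow> ('a::euclidean_space \<Rightarrow> real) \<Rightarrow> 'a \<Rightarrow> real" where
  "frac_laplacian s u x = (THE L. has_frac_laplacian s u L x)"

definition frac_laplacian_exists :: "real \<Rightarrow> ('a::euclidean_space \<Rightarrow> real) \<Rightarrow> 'a \<Rightarrow> bool" where
  "frac_laplacian_exists s u x \<longleftrightarrow> (\<exists>L. has_frac_laplacian s u L x)"

text \<open>\<open>u\<close> is a classical solution, on the whole space, of the obstacle problem for
  \<open>(-\<Delta>)\<^sup>s\<close> with obstacle \<open>\<phi>\<close>.\<close>

definition frac_obstacle_solution ::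
    "real \<Rightarrow> ('a::euclidean_space \<Rightarrow> real) \<Rightarrow> ('a \<Rightarrow> real) \<Rightarrow> bool" where
  "frac_obstacle_solution s \<phi> u \<longleftrightarrow>
     continuous_on UNIV u \<and> (\<forall>x. frac_laplacian_exists s u x) \<and>
     (\<forall>x. frac_laplacian s u x \<ge> 0) \<and>
     (\<forall>x\<in>{x. u x > \<phi> x}. frac_laplacian s u x = 0) \<and>
     (\<forall>x. u x \<ge> \<phi> x)"

definition contact_set :: "('a \<Rightarrow> real) \<Rightarrow> ('a \<Rightarrow> real) \<Rightarrow> 'a set" where
  "contact_set \<phi> u = {x. u x = \<phi> x}"

text \<open>The case distinction for \<open>d = 0\<close> is needed because \<open>0 powr 0 = 0\<close> in HOL,
  whereas a nonempty set must have weight 1 for the counting measure.\<close>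

definition hausdorff_weight :: "real \<Rightarrow> 'a::metric_space set \<Rightarrow> ennreal" where
  "hausdorff_weight d U =
     (if U = {} then 0 else if d = 0 then 1 else ennreal (diameter U powr d))"

text \<open>Boundedness is required since \<open>diameter\<close> is a real number, unspecified on unbounded
  sets. Finite covers are included because the sets of a cover may be empty.\<close>

definition hausdorff_content :: "real \<Rightarrow> real \<Rightarrow> 'a::metric_space set \<Rightarrow> ennreal" where
  "hausdorff_content d \<delta> A =
     (INF U \<in> {U :: nat \<Rightarrow> 'a set. A \<subseteq> (\<Union>i. U i) \<and>
                 (\<forall>i. bounded (U i) \<and> diameter (U i) \<le> \<delta>)}.
        \<Sum>i. hausdorff_weight d (U i))"

definition hausdorff_measure :: "real \<Rightarrow> 'a::metric_space set \<Rightarrow> ennreal" where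
  "hausdorff_measure d A = (SUP \<delta>\<in>{0<..}. hausdorff_content d \<delta> A)"

definition hausdorff_dim :: "'a::metric_space set \<Rightarrow> ereal" where
  "hausdorff_dim A = Inf (ereal ` {d. 0 \<le> d \<and> hausdorff_measure d A = 0})"

end

theory Submission
  imports Defs "HOL-Real_Asymp.Real_Asymp"
begin

text \<open>Everything depends on one coordinate \<open>x\<^sub>1\<close> only. The function \<open>-(x\<^sub>1)\<^sub>+\<^sup>s\<close> is \<open>s\<close>-harmonic
  where \<open>x\<^sub>1 > 0\<close> and \<open>s\<close>-superharmonic where \<open>x\<^sub>1 < 0\<close>. Averaging its translates
  against a smooth density \<open>\<rho> \<ge> 0\<close> supported in \<open>[-1, 0]\<close> gives a smooth \<open>u\<close> with
  \<open>(-\<Delta>)\<^sup>s u \<ge> 0\<close> everywhere and \<open>(-\<Delta>)\<^sup>s u = 0\<close> where \<open>x\<^sub>1 \<ge> 0\<close>. Hence \<open>u\<close> solves the obstacle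
  problem for every obstacle \<open>u - \<eta>\<close> with \<open>\<eta> \<ge> 0\<close> smooth and vanishing where \<open>x\<^sub>1 \<le> 0\<close>, and the
  contact set is the zero set of \<open>\<eta>\<close>. On \<open>x\<^sub>1 > 0\<close> we let \<open>\<eta>\<close> vanish exactly where \<open>x\<^sub>1\<close> avoids a union
  of short open intervals around all rationals: a closed set of positive Lebesgue measure with
  empty interior. It is contained in the free boundary, which therefore has full dimension.\<close>

section \<open>Smooth functions on the real line\<close>

text \<open>The bare profile \<open>pos_powr s\<close> is only Hoelder continuous at 0, and its
  truncated integrals there blow up like r^(-s) as r tends to 0. The obstacle must be smooth, and a
  classical value is required at every point. Averaging cures both: derivatives fall on \<rho>, and
  a singularity of order -s is integrable because s < 1. The one hard computation is that the
  profile is s-harmonic on the positive side. Homogeneity reduces it to the point 1, and reflecting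
  z to -z turns the principal value into an absolutely convergent integral of a second difference.
  Projected to one coordinate the kernel is a multiple of t^(-1-2s); the constant never has to be
  computed, since the integral to be found is zero. It is zero because a primitive of the
  one-dimensional integrand has the same limit at 0 and at infinity. On the negative side the sign
  is immediate: the profile vanishes at the point and is nonnegative elsewhere.\<close>

primrec times_differentiable :: "nat \<Rightarrow> (real \<Rightarrow> real) \<Rightarrow> bool" where
  "times_differentiable 0 f \<longleftrightarrow> continuous_on UNIV f"
| "times_differentiable (Suc k) f \<longleftrightarrow>
     (\<exists>f'. (\<forall>x. (f has_real_derivative f' x) (at x)) \<and> times_differentiable k f')"

definition smooth_real :: "(real \<Rightarrow> real) \<Rightarrow> bool" where
  "smooth_real f \<longleftrightarrow> (\<forall>k. times_differentiable k f)"

lemma times_differentiable_SucD: "times_differentiable (Suc k) f \<Longrightarrow> times_differentiable k f"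
proof (induction k arbitrary: f)
  case 0
  then show ?case
    by (auto intro!: continuous_at_imp_continuous_on intro: DERIV_isCont)
next
  case (Suc k)
  then show ?case
    by (metis times_differentiable.simps(2))
qed

lemma times_differentiable_add:
  "times_differentiable k f \<Longrightarrow> times_differentiable k g \<Longrightarrow> times_differentiable k (\<lambda>x. f x + g x)"
proof (induction k arbitrary: f g)
  case 0
  then show ?case by (auto intro: continuous_on_add)
next
  case (Suc k)
  then obtain f' g' where d: "\<And>x. (f has_real_derivative f' x) (at x)" "\<And>x. (g has_real_derivative g' x) (at x)"
    and t: "times_differentiable k f'" "times_differentiable k g'"
    by auto
  have "((\<lambda>x. f x + g x) has_real_derivative f' x + g' x) (at x)" for x
    by (intro DERIV_add d)
  with Suc.IH[OF t] show ?case
    unfolding times_differentiable.simps by (intro exI[of _ "\<lambda>x. f' x + g' x"]) simp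
qed

lemma times_differentiable_mult:
  "times_differentiable k f \<Longrightarrow> times_differentiable k g \<Longrightarrow> times_differentiable k (\<lambda>x. f x * g x)"
proof (induction k arbitrary: f g)
  case 0
  then show ?case by (auto intro: continuous_on_mult)
next
  case (Suc k)
  obtain f' g' where d: "\<And>x. (f has_real_derivative f' x) (at x)" "\<And>x. (g has_real_derivative g' x) (at x)"
    and t: "times_differentiable k f'" "times_differentiable k g'"
    using Suc.prems by auto
  have "times_differentiable k (\<lambda>x. f' x * g x + g' x * f x)"
    using Suc.prems[THEN times_differentiable_SucD] t
    by (intro times_differentiable_add Suc.IH)
  moreover have "((\<lambda>x. f x * g x) has_real_derivative f' x * g x + g' x * f x) (at x)" for x
    by (intro DERIV_mult d)
  ultimately show ?case
    unfolding times_differentiable.simps by (intro exI[of _ "\<lambda>x. f' x * g x + g' x * f x"]) simp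
qed

lemma smooth_real_mult: "smooth_real f \<Longrightarrow> smooth_real g \<Longrightarrow> smooth_real (\<lambda>x. f x * g x)"
  by (simp add: smooth_real_def times_differentiable_mult)

text \<open>Meant for families closed under differentiation: all successive derivatives are supplied
  at once, and the induction on the order runs simultaneously for every \<open>D k\<close>.
  Applications write the function as \<open>(...) 0\<close> so that it matches
  \<open>D 0\<close>.\<close>

lemma smooth_realI:
  assumes "\<And>k x. (D k has_real_derivative D (Suc k) x) (at x)"
  shows "smooth_real (D 0)"
proof -
  have "times_differentiable j (D k)" for j k
  proof (induction j arbitrary: k)
    case 0
    then show ?case
      using assms by (auto intro!: continuous_at_imp_continuous_on DERIV_isCont)
  next
    case (Suc j)
    then show ?case
      using assms by auto
  qed
  then show ?thesis
    by (simp add: smooth_real_def)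
qed

text \<open>The derivative witness in the definition may depend on the order \<open>k\<close>.
  Uniqueness of derivatives identifies all witnesses, so one derivative is itself smooth and a
  choice of it can be iterated.\<close>

lemma smooth_realE:
  assumes "smooth_real f"
  obtains D where "D 0 = f" "\<And>k x. (D k has_real_derivative D (Suc k) x) (at x)"
proof -
  have ex: "\<exists>g'. smooth_real g' \<and> (\<forall>x. (g has_real_derivative g' x) (at x))" if "smooth_real g" for g
  proof -
    have "\<exists>g'. (\<forall>x. (g has_real_derivative g' x) (at x)) \<and> times_differentiable k g'" for k
      using that unfolding smooth_real_def by (metis times_differentiable.simps(2))
    then obtain G where G: "\<And>k x. (g has_real_derivative G k x) (at x)" "\<And>k. times_differentiable k (G k)"
      by metis
    have "G k = G 0" for k
      using G(1) DERIV_unique by blast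
    with G show ?thesis
      unfolding smooth_real_def by metis
  qed
  then obtain d where d: "\<And>g. smooth_real g \<Longrightarrow> smooth_real (d g)"
     "\<And>g x. smooth_real g \<Longrightarrow> (g has_real_derivative d g x) (at x)"
    by metis
  have sm: "smooth_real ((d ^^ k) f)" for k
    by (induction k) (use assms d in auto)
  show ?thesis
    by (rule that[of "\<lambda>k. (d ^^ k) f"]) (use d sm in auto)
qed

lemma smooth_real_continuous: "smooth_real f \<Longrightarrow> continuous_on S f"
  unfolding smooth_real_def
  by (metis continuous_on_subset subset_UNIV times_differentiable.simps(1))

lemma smooth_real_diff:
  assumes "smooth_real f" "smooth_real g"
  shows "smooth_real (\<lambda>x. f x - g x)"
proof -
  obtain F where F: "F 0 = f" "\<And>k x. (F k has_real_derivative F (Suc k) x) (at x)"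
    using smooth_realE[OF assms(1)] by blast
  obtain G where G: "G 0 = g" "\<And>k x. (G k has_real_derivative G (Suc k) x) (at x)"
    using smooth_realE[OF assms(2)] by blast
  have "smooth_real ((\<lambda>k x. F k x - G k x) 0)"
    by (rule smooth_realI) (use F G in \<open>auto intro!: derivative_intros\<close>)
  then show ?thesis using F G by simp
qed

lemma smooth_real_affine:
  assumes "smooth_real f"
  shows "smooth_real (\<lambda>x. f (a * x + b))"
proof -
  obtain F where F: "F 0 = f" "\<And>k x. (F k has_real_derivative F (Suc k) x) (at x)"
    using smooth_realE[OF assms(1)] by blast
  have "smooth_real ((\<lambda>k x. a ^ k * F k (a * x + b)) 0)"
    by (rule smooth_realI)
      (auto intro!: derivative_eq_intros DERIV_chain2[OF F(2)])
  then show ?thesis using F by simp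
qed

lemma smooth_real_uminus:
  assumes "smooth_real f"
  shows "smooth_real (\<lambda>x. - f x)"
  using smooth_real_diff[of "\<lambda>_. 0" f] smooth_realI[of "\<lambda>_ _. 0"] assms by auto

lemma C_infinity_component:
  assumes "smooth_real f"
  shows "C_infinity (\<lambda>x::real^'n. f (x $ i))"
proof -
  \<comment> \<open>The factor \<open>c\<close> closes the induction: differentiating in direction
    \<open>v\<close> gives the same shape with \<open>f'\<close> and the constant
    \<open>v $ i * c\<close>.\<close>
  have "C_k k (\<lambda>x::real^'n. f (x $ i) * c)" if "times_differentiable k f" for k c f
    using that
  proof (induction k arbitrary: f c)
    case 0
    then show ?case
      by (auto intro!: continuous_intros continuous_on_compose2[of UNIV f])
  next
    case (Suc k)
    then obtain f' where f': "\<And>x. (f has_real_derivative f' x) (at x)" "times_differentiable k f'"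
      by auto
    have D: "((\<lambda>x::real^'n. f (x $ i) * c) has_derivative (\<lambda>v. f' (x $ i) * (v $ i * c))) (at x)" for x
    proof -
      have "((\<lambda>x::real^'n. f (x $ i)) has_derivative (\<lambda>v. f' (x $ i) * v $ i)) (at x)"
        using has_derivative_compose[OF bounded_linear_imp_has_derivative[OF bounded_linear_vec_nth]
            f'(1)[unfolded has_field_derivative_def]] .
      then show ?thesis
        by (auto intro!: derivative_eq_intros simp: mult.assoc)
    qed
    have fd: "frechet_derivative (\<lambda>x::real^'n. f (x $ i) * c) (at x) = (\<lambda>v. f' (x $ i) * (v $ i * c))" for x
      using frechet_derivative_at[OF D] by simp
    show ?case
      using D Suc.IH[OF f'(2)] unfolding C_k.simps fd differentiable_def mult.assoc[symmetric]
      by (simp add: mult.assoc) blast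
  qed
  from this[of _ f 1] show ?thesis
    using assms by (simp add: C_infinity_def smooth_real_def)
qed

section \<open>Flat functions and series of bumps\<close>

definition flat_exp :: "real \<Rightarrow> real" where
  "flat_exp x = (if x \<le> 0 then 0 else exp (- inverse x))"

lemma flat_exp_nonneg: "flat_exp x \<ge> 0"
  by (auto simp: flat_exp_def)

text \<open>With y = 1/x, the functions p(y) exp(-y), extended by 0, are closed under
  differentiation: since dy/dx = -y^2, the polynomial p becomes y^2 (p - p'), which is
  \<open>q p\<close>. At 0 the difference quotient from the right is y p(y) exp(-y) with y tending
  to infinity, hence the auxiliary polynomial \<open>[:0,1:] * p\<close>.\<close>

lemma smooth_flat_exp: "smooth_real flat_exp"
proof -
  define P where "P p x = (if x \<le> 0 then 0 else poly p (inverse x) * exp (- inverse x))" for p and x :: real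
  define q where "q p = [:0,0,1:] * (p - pderiv p)" for p :: "real poly"
  have lim: "((\<lambda>y. poly p y * exp (- y)) \<longlongrightarrow> 0) at_top" for p :: "real poly"
  proof -
    have "((\<lambda>y. \<Sum>i\<le>degree p. coeff p i * (y ^ i / exp y)) \<longlongrightarrow> (\<Sum>i\<le>degree p. coeff p i * 0)) at_top"
      by (intro tendsto_intros tendsto_power_div_exp_0)
    then show ?thesis
      by (simp add: poly_altdef exp_minus sum_distrib_right divide_inverse mult.assoc)
  qed
  have DP: "(P p has_real_derivative P (q p) x) (at x)" for p x
  proof (cases x "0::real" rule: linorder_cases)
    case less
    have "((\<lambda>_. 0) has_real_derivative 0) (at x)" by simp
    then have "(P p has_real_derivative 0) (at x)"
      by (rule has_field_derivative_transform_within_open[of _ _ _ "{..<0}"]) (use less in \<open>auto simp: P_def\<close>)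
    then show ?thesis using less by (simp add: P_def)
  next
    case greater
    have "((\<lambda>x. poly p (inverse x) * exp (- inverse x)) has_real_derivative P (q p) x) (at x)"
      using greater
      by (auto intro!: derivative_eq_intros DERIV_chain2[OF poly_DERIV] simp: P_def q_def field_simps power2_eq_square)
    then show ?thesis
      by (rule has_field_derivative_transform_within_open[of _ _ _ "{0<..}"]) (use greater in \<open>auto simp: P_def\<close>)
  next
    case equal
    have "((\<lambda>y. (P p y - P p 0) / (y - 0)) \<longlongrightarrow> 0) (at_left 0)"
      by (rule Lim_transform_eventually[OF tendsto_const])
        (auto simp: P_def eventually_at_filter)
    moreover have "((\<lambda>y. (P p y - P p 0) / (y - 0)) \<longlongrightarrow> 0) (at_right 0)"
    proof -
      have "((\<lambda>y. (P p (inverse y)) * y) \<longlongrightarrow> 0) at_top"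
        by (rule Lim_transform_eventually[OF lim[of "[:0,1:] * p"]], rule eventually_mono[OF eventually_gt_at_top[of 0]])
          (auto simp: P_def)
      then show ?thesis
        by (simp add: filterlim_at_right_to_top P_def divide_inverse)
    qed
    ultimately have "((\<lambda>y. (P p y - P p 0) / (y - 0)) \<longlongrightarrow> 0) (at 0)"
      by (simp add: filterlim_at_split)
    then show ?thesis
      using equal by (simp add: has_field_derivative_iff P_def)
  qed
  have "smooth_real ((\<lambda>k. P ((q ^^ k) 1)) 0)"
    by (rule smooth_realI) (use DP in auto)
  moreover have "P 1 = flat_exp" by (auto simp: P_def flat_exp_def)
  ultimately show ?thesis by simp
qed

lemma derivatives_eq_0_outside:
  fixes D :: "nat \<Rightarrow> real \<Rightarrow> real"
  assumes "\<And>k x. (D k has_real_derivative D (Suc k) x) (at x)"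
    and "\<And>x. x \<notin> {a..b} \<Longrightarrow> D 0 x = 0" and "x \<notin> {a..b}"
  shows "D k x = 0"
  using assms(3)
proof (induction k arbitrary: x)
  case 0
  then show ?case using assms(2) by simp
next
  case (Suc k)
  have "((\<lambda>_. 0) has_real_derivative 0) (at x)" by simp
  then have "(D k has_real_derivative 0) (at x)"
    by (rule has_field_derivative_transform_within_open[of _ _ _ "- {a..b}"]) (use Suc in auto)
  then show ?case
    using assms(1) DERIV_unique by blast
qed

lemma derivatives_bounded:
  fixes D :: "nat \<Rightarrow> real \<Rightarrow> real"
  assumes "\<And>k x. (D k has_real_derivative D (Suc k) x) (at x)"
    and "\<And>x. x \<notin> {a..b} \<Longrightarrow> D 0 x = 0"
  obtains M where "\<And>x. \<bar>D k x\<bar> \<le> M" "M > 0"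
proof -
  have "continuous_on {a..b} (D k)"
    using assms(1) by (auto intro!: continuous_at_imp_continuous_on intro: DERIV_isCont)
  then have "bounded (D k ` {a..b})"
    by (intro compact_imp_bounded compact_continuous_image) auto
  then obtain M where M: "\<forall>x\<in>{a..b}. \<bar>D k x\<bar> \<le> M" "M > 0"
    unfolding bounded_pos by auto
  have "\<bar>D k x\<bar> \<le> M" for x
    using M derivatives_eq_0_outside[of D a b x k, OF assms] by (cases "x \<in> {a..b}") auto
  with M that show ?thesis by blast
qed

text \<open>A diagonal choice of weights: \<open>c k\<close> controls the derivatives of orders 0 to
  k of the k-th bump, so for fixed order j the differentiated series is dominated by a geometric one
  from index j on. Bounded support makes every derivative bounded.\<close>

lemma smooth_real_series:
  fixes b :: "nat \<Rightarrow> real \<Rightarrow> real"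
  assumes "\<And>k. smooth_real (b k)" and supp: "\<And>k x. x \<notin> {l k..u k} \<Longrightarrow> b k x = 0"
  obtains c where "\<And>k. 0 < c k" "\<And>x. summable (\<lambda>k. c k * b k x)"
    "smooth_real (\<lambda>x. \<Sum>k. c k * b k x)"
proof -
  have "\<exists>D. D 0 = b k \<and> (\<forall>j x. (D j has_real_derivative D (Suc j) x) (at x))" for k
    using smooth_realE[OF assms(1)] by metis
  then obtain D where D0: "\<And>k. D k 0 = b k"
    and D: "\<And>k j x. (D k j has_real_derivative D k (Suc j) x) (at x)"
    by metis
  have "\<exists>M>0. \<forall>x. \<bar>D k j x\<bar> \<le> M" for k j
    using derivatives_bounded[of "D k" "l k" "u k" j] D D0 supp by metis
  then obtain M where M: "\<And>k j x. \<bar>D k j x\<bar> \<le> M k j" "\<And>k j. M k j > 0"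
    by metis
  define c where "c k = (1/2) ^ k / (1 + (\<Sum>j\<le>k. M k j))" for k
  have den: "1 + (\<Sum>j\<le>k. M k j) > 0" for k
    using M(2) by (simp add: add_pos_nonneg sum_nonneg less_imp_le)
  have c_pos: "c k > 0" for k
    unfolding c_def using den by simp
  have bound: "\<bar>c k * D k j x\<bar> \<le> (1/2) ^ k" if "j \<le> k" for k j x
  proof -
    have "\<bar>D k j x\<bar> \<le> M k j" by (rule M)
    also have "\<dots> \<le> (\<Sum>j\<le>k. M k j)"
      using that M(2) by (intro member_le_sum) (auto intro: less_imp_le)
    finally have "\<bar>D k j x\<bar> \<le> 1 + (\<Sum>j\<le>k. M k j)" by simp
    then show ?thesis
      using den[of k] mult_left_mono[of "\<bar>D k j x\<bar>" "1 + (\<Sum>j\<le>k. M k j)" "(1/2) ^ k :: real"]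
      unfolding c_def by (simp add: abs_mult pos_divide_le_eq)
  qed
  have unif: "uniformly_convergent_on UNIV (\<lambda>n x. \<Sum>i<n. c i * D i j x)" for j
    unfolding uniformly_convergent_on_def
    by (rule exI, rule Weierstrass_m_test_ev[where M = "\<lambda>i. (1/2) ^ i"])
      (auto simp: summable_geometric eventually_sequentially intro!: exI[of _ j] bound[simplified])
  have summ: "summable (\<lambda>i. c i * D i j x)" for j x
    by (rule summable_comparison_test[of _ "\<lambda>i. (1/2) ^ i"])
      (auto simp: summable_geometric intro!: exI[of _ j] bound[simplified])
  have "smooth_real ((\<lambda>j x. \<Sum>k. c k * D k j x) 0)"
  proof (rule smooth_realI)
    fix j x
    show "((\<lambda>x. \<Sum>k. c k * D k j x) has_real_derivative (\<Sum>k. c k * D k (Suc j) x)) (at x)"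
      by (rule has_field_derivative_series'(2)[where S=UNIV and ?x0.0=0])
        (auto intro!: DERIV_cmult D unif summ)
  qed
  with c_pos summ[of 0] D0 that[of c] show ?thesis by simp
qed

text \<open>Each bump is positive exactly on its interval. All terms of the series are nonnegative,
  so no cancellation can create further zeros.\<close>

lemma smooth_function_of_open_Union:
  fixes l u :: "nat \<Rightarrow> real"
  obtains \<eta> where "smooth_real \<eta>" "\<And>x. \<eta> x \<ge> 0" "\<And>x. \<eta> x = 0 \<longleftrightarrow> x \<notin> (\<Union>k. {l k<..<u k})"
proof -
  define b where "b k x = flat_exp (x - l k) * flat_exp (u k - x)" for k x
  have "smooth_real (b k)" for k
    using smooth_real_mult[OF smooth_real_affine[of flat_exp 1 "- l k"] smooth_real_affine[of flat_exp "-1" "u k"]]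
      smooth_flat_exp unfolding b_def by simp
  moreover have "b k x = 0" if "x \<notin> {l k..u k}" for k x
    using that by (auto simp: b_def flat_exp_def)
  ultimately obtain c where c: "\<And>k. 0 < c k" "\<And>x. summable (\<lambda>k. c k * b k x)"
    "smooth_real (\<lambda>x. \<Sum>k. c k * b k x)"
    using smooth_real_series[of b l u] by metis
  have b_nonneg: "b k x \<ge> 0" for k x
    by (simp add: b_def flat_exp_nonneg)
  have b_0: "b k x = 0 \<longleftrightarrow> x \<notin> {l k<..<u k}" for k x
    by (auto simp: b_def flat_exp_def)
  have nn: "0 \<le> c k * b k x" for k x
    using c(1)[of k] b_nonneg[of k x] by simp
  have "(\<Sum>k. c k * b k x) = 0 \<longleftrightarrow> x \<notin> (\<Union>k. {l k<..<u k})" for x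
  proof -
    have "(\<Sum>k. c k * b k x) = 0 \<longleftrightarrow> (\<forall>k. c k * b k x = 0)"
      using suminf_eq_zero_iff[OF c(2) nn] .
    also have "\<dots> \<longleftrightarrow> (\<forall>k. b k x = 0)"
      using c(1) by (auto simp: less_le)
    finally show ?thesis using b_0 by auto
  qed
  moreover have "(\<Sum>k. c k * b k x) \<ge> 0" for x
    using nn c(2) by (simp add: suminf_nonneg)
  ultimately show ?thesis
    using that[of "\<lambda>x. \<Sum>k. c k * b k x"] c(3) by blast
qed

section \<open>Tails of homogeneous kernels\<close>

lemma nn_integral_lborel_affine:
  fixes t :: "'a::euclidean_space"
  assumes "c \<noteq> 0" and [measurable]: "f \<in> borel_measurable borel"
  shows "(\<integral>\<^sup>+z. f z \<partial>lborel) = ennreal (\<bar>c\<bar> ^ DIM('a)) * (\<integral>\<^sup>+z. f (t + c *\<^sub>R z) \<partial>lborel)"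
  by (subst lborel_affine[OF assms(1), of t])
    (simp add: nn_integral_density nn_integral_distr nn_integral_cmult)

lemma integrable_lborel_affine:
  fixes t :: "'a::euclidean_space" and f :: "'a \<Rightarrow> real"
  assumes "c \<noteq> 0" and [measurable]: "f \<in> borel_measurable borel"
  shows "integrable lborel (\<lambda>z. f (t + c *\<^sub>R z)) \<longleftrightarrow> integrable lborel f"
  using assms(1)
  by (subst (2) lborel_affine[OF assms(1), of t])
    (simp add: integrable_density integrable_distr_eq)

lemma integral_lborel_affine:
  fixes t :: "'a::euclidean_space" and f :: "'a \<Rightarrow> real"
  assumes "c \<noteq> 0" and [measurable]: "f \<in> borel_measurable borel"
  shows "(\<integral>z. f z \<partial>lborel) = \<bar>c\<bar> ^ DIM('a) * (\<integral>z. f (t + c *\<^sub>R z) \<partial>lborel)"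
  by (subst lborel_affine[OF assms(1), of t])
    (simp add: integral_density integral_distr)

lemma term_le_suminf:
  fixes f :: "nat \<Rightarrow> ennreal"
  shows "f k \<le> (\<Sum>k. f k)"
  using sum_le_suminf[OF summableI, of "{k}" f] by simp

text \<open>Dyadic shells: where 2^k \<le> |z| < 2^(k+1) the integrand is at most 2^(-pk), and the
  shell lies in a ball of volume V 2^n 2^(kn). The resulting geometric series has ratio 2^(n-p) <
  1.\<close>

lemma nn_integral_norm_powr_tail:
  assumes p: "real DIM('a) < p"
  shows "(\<integral>\<^sup>+z. ennreal (indicator {z. 1 \<le> norm z} z * norm z powr - p) \<partial>(lborel :: 'a::euclidean_space measure)) < \<infinity>"
proof -
  let ?n = "DIM('a)"
  define V where "V = unit_ball_vol (real ?n)"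
  have "ennreal (indicator {z. 1 \<le> norm z} z * norm z powr - p)
      \<le> (\<Sum>k. ennreal ((2 powr - p) ^ k) * indicator (cball 0 (2 ^ Suc k)) z)" for z :: 'a
  proof (cases "1 \<le> norm z")
    case True
    obtain k where k: "2 ^ k \<le> norm z" "norm z < 2 ^ Suc k"
    proof -
      define m where "m = nat \<lfloor>log 2 (norm z)\<rfloor>"
      have "0 \<le> log 2 (norm z)" using True by (subst zero_le_log_cancel_iff) auto
      then have "real m \<le> log 2 (norm z)" "log 2 (norm z) < real (Suc m)"
        unfolding m_def by linarith+
      then have "2 powr real m \<le> norm z" "norm z < 2 powr real (Suc m)"
        using less_le_trans[OF zero_less_one True] by (simp_all only: le_log_iff[of 2] log_less_iff[of 2] one_less_numeral_iff semiring_norm)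
      then show ?thesis using that[of m] by (simp add: powr_realpow del: of_nat_Suc power_Suc)
    qed
    have "norm z powr - p \<le> (2 ^ k) powr - p"
      using k p by (intro powr_mono2') auto
    also have "\<dots> = (2 powr - p) ^ k"
      by (simp add: powr_realpow[symmetric] powr_powr mult.commute powr_power)
    finally have "ennreal (indicator {z. 1 \<le> norm z} z * norm z powr - p) \<le> ennreal ((2 powr - p) ^ k) * indicator (cball 0 (2 ^ Suc k)) z"
      using True k by (auto simp: indicator_def intro!: ennreal_leI)
    also have "\<dots> \<le> (\<Sum>k. ennreal ((2 powr - p) ^ k) * indicator (cball 0 (2 ^ Suc k)) z)"
      using term_le_suminf[of "\<lambda>k. ennreal ((2 powr - p) ^ k) * indicator (cball 0 (2 ^ Suc k)) z" k] .
    finally show ?thesis .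
  qed auto
  then have "(\<integral>\<^sup>+z. ennreal (indicator {z. 1 \<le> norm z} z * norm z powr - p) \<partial>(lborel :: 'a measure))
     \<le> (\<integral>\<^sup>+z. (\<Sum>k. ennreal ((2 powr - p) ^ k) * indicator (cball 0 (2 ^ Suc k)) (z::'a)) \<partial>lborel)"
    by (intro nn_integral_mono)
  also have "\<dots> = (\<Sum>k. ennreal ((2 powr - p) ^ k) * emeasure lborel (cball (0::'a) (2 ^ Suc k)))"
  proof -
    have "(\<integral>\<^sup>+z. (\<Sum>k. ennreal ((2 powr - p) ^ k) * indicator (cball 0 (2 ^ Suc k)) (z::'a)) \<partial>lborel)
      = (\<Sum>k. \<integral>\<^sup>+z. ennreal ((2 powr - p) ^ k) * indicator (cball 0 (2 ^ Suc k)) (z::'a) \<partial>lborel)"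
      by (rule nn_integral_suminf) (intro borel_measurable_times_ennreal borel_measurable_const borel_measurable_indicator, simp)
    also have "\<dots> = (\<Sum>k. ennreal ((2 powr - p) ^ k) * emeasure lborel (cball (0::'a) (2 ^ Suc k)))"
      by (intro suminf_cong nn_integral_cmult_indicator) simp
    finally show ?thesis .
  qed
  also have "\<dots> = (\<Sum>k. ennreal (V * 2 ^ ?n * (2 powr (real ?n - p)) ^ k))"
  proof (rule suminf_cong)
    fix k
    have "(2 powr - p) ^ k * (V * (2 ^ Suc k) ^ ?n) = V * 2 ^ ?n * ((2 powr - p) * 2 ^ ?n) ^ k"
      by (simp add: power_mult_distrib power_mult[symmetric] mult_ac)
    also have "(2 powr - p) * 2 ^ ?n = 2 powr (real ?n - p)"
      by (simp add: powr_realpow[symmetric] powr_add[symmetric])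
    finally have eq: "(2 powr - p) ^ k * (V * (2 ^ Suc k) ^ ?n) = V * 2 ^ ?n * (2 powr (real ?n - p)) ^ k" .
    have "emeasure lborel (cball (0::'a) (2 ^ Suc k)) = ennreal (V * (2 ^ Suc k) ^ ?n)"
      unfolding V_def by (rule emeasure_cball) simp
    then show "ennreal ((2 powr - p) ^ k) * emeasure lborel (cball (0::'a) (2 ^ Suc k))
      = ennreal (V * 2 ^ ?n * (2 powr (real ?n - p)) ^ k)"
      unfolding eq[symmetric] by (subst ennreal_mult') simp_all
  qed
  also have "\<dots> < \<infinity>"
  proof -
    have "2 powr (real ?n - p) < 1" using p by (simp add: powr_less_one)
    then have "summable (\<lambda>k. V * 2 ^ ?n * (2 powr (real ?n - p)) ^ k)"
      by (intro summable_mult summable_geometric) simp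
    then show ?thesis
      unfolding V_def by (subst suminf_ennreal2) auto
  qed
  finally show ?thesis .
qed

lemma integrable_norm_powr_tail:
  assumes p: "real DIM('a) < p" and r: "0 < r"
  shows "integrable lborel (\<lambda>z::'a::euclidean_space. indicator {z. r \<le> norm z} z * norm z powr - p)"
proof -
  have 1: "integrable lborel (\<lambda>z::'a. indicator {z. 1 \<le> norm z} z * norm z powr - p)"
    using nn_integral_norm_powr_tail[OF p] by (intro integrableI_nonneg) auto
  have "integrable lborel (\<lambda>z::'a. r powr - p * (indicator {z. 1 \<le> norm z} z * norm z powr - p))"
    using 1 by simp
  also have "(\<lambda>z::'a. r powr - p * (indicator {z. 1 \<le> norm z} z * norm z powr - p))
    = (\<lambda>z. (\<lambda>z. indicator {z. r \<le> norm z} z * norm z powr - p) (0 + r *\<^sub>R z))"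
    using r by (auto simp: fun_eq_iff indicator_def powr_mult)
  finally show ?thesis
    using r by (subst (asm) integrable_lborel_affine) auto
qed

lemma integral_norm_powr_tail:
  assumes r: "0 < r"
  shows "(\<integral>z. indicator {z. r \<le> norm z} z * norm z powr - p \<partial>(lborel :: 'a::euclidean_space measure))
     = r powr (real DIM('a) - p) * (\<integral>z. indicator {z. 1 \<le> norm z} z * norm z powr - p \<partial>(lborel :: 'a measure))"
proof -
  have "(\<integral>z. indicator {z. r \<le> norm z} z * norm z powr - p \<partial>(lborel :: 'a measure))
    = \<bar>r\<bar> ^ DIM('a) * (\<integral>z. indicator {z. r \<le> norm z} (0 + r *\<^sub>R z) * norm (0 + r *\<^sub>R z) powr - p \<partial>(lborel :: 'a measure))"
    using r by (intro integral_lborel_affine) auto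
  also have "(\<lambda>z::'a. indicator {z. r \<le> norm z} (0 + r *\<^sub>R z) * norm (0 + r *\<^sub>R z) powr - p)
    = (\<lambda>z. r powr - p * (indicator {z. 1 \<le> norm z} z * norm z powr - p))"
    using r by (auto simp: fun_eq_iff indicator_def powr_mult)
  finally have "(\<integral>z. indicator {z. r \<le> norm z} z * norm z powr - p \<partial>(lborel :: 'a measure))
    = (r ^ DIM('a) * r powr - p) * (\<integral>z. indicator {z. 1 \<le> norm z} z * norm z powr - p \<partial>(lborel :: 'a measure))"
    using r by (simp only: integral_mult_right_zero abs_of_pos mult.assoc)
  also have "r ^ DIM('a) * r powr - p = r powr (real DIM('a) - p)"
    using r by (simp add: powr_realpow[symmetric] powr_add[symmetric])
  finally show ?thesis .
qed

text \<open>Both sides are homogeneous of degree \<open>- 2 * s\<close> under dilations, so it is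
  enough to compare one tail.\<close>

lemma distr_norm_powr_inner:
  fixes e :: "'a::euclidean_space"
  assumes e: "e \<in> Basis" and s: "0 < s"
  obtains c where "c \<ge> 0"
    "distr (density lborel (\<lambda>z::'a. ennreal (indicator {z. 0 < z \<bullet> e} z * norm z powr - (real DIM('a) + 2 * s)))) borel (\<lambda>z. z \<bullet> e)
      = density lborel (\<lambda>t::real. ennreal (c * (indicator {0<..} t * t powr (- 1 - 2 * s))))"
proof -
  let ?q = "real DIM('a) + 2 * s"
  define M where "M = distr (density lborel (\<lambda>z::'a. ennreal (indicator {z. 0 < z \<bullet> e} z * norm z powr - ?q))) borel (\<lambda>z. z \<bullet> e)"
  define C where "C = emeasure M {1<..}"
  \<comment> \<open>The factor \<open>2 * s\<close> comes from the integral of t^(-1-2s) over (a,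
    \<infinity>), which is a^(-2s)/(2s); it makes the tails beyond 1 agree.\<close>
  define c where "c = 2 * s * enn2real C"
  define N where "N = density lborel (\<lambda>t::real. ennreal (c * (indicator {0<..} t * t powr (- 1 - 2 * s))))"
  have sM: "sets M = sets borel" "sets N = sets borel" by (simp_all add: M_def N_def)
  have eM: "emeasure M A = (\<integral>\<^sup>+z. ennreal (indicator {z. 0 < z \<bullet> e} z * norm z powr - ?q) * indicator A (z \<bullet> e) \<partial>lborel)"
    if "A \<in> sets borel" for A
    using that unfolding M_def
    by (subst nn_integral_indicator[symmetric], simp, subst nn_integral_distr, simp, simp,
        subst nn_integral_density) auto
  have scale: "emeasure M {a<..} = ennreal (a powr (- 2 * s)) * C" if a: "a > 0" for a
  proof -
    have "emeasure M {a<..} = (\<integral>\<^sup>+z. ennreal (indicator {z. 0 < z \<bullet> e} z * norm z powr - ?q) * indicator {a<..} (z \<bullet> e) \<partial>lborel)"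
      by (rule eM) simp
    also have "\<dots> = ennreal (\<bar>a\<bar> ^ DIM('a)) * (\<integral>\<^sup>+z. (ennreal (indicator {z. 0 < z \<bullet> e} (0 + a *\<^sub>R z) * norm (0 + a *\<^sub>R z) powr - ?q) * indicator {a<..} ((0 + a *\<^sub>R z) \<bullet> e)) \<partial>lborel)"
      using a by (intro nn_integral_lborel_affine) auto
    also have "(\<integral>\<^sup>+z. (ennreal (indicator {z. 0 < z \<bullet> e} (0 + a *\<^sub>R z) * norm (0 + a *\<^sub>R z) powr - ?q) * indicator {a<..} ((0 + a *\<^sub>R z) \<bullet> e)) \<partial>lborel)
      = (\<integral>\<^sup>+z. ennreal (a powr - ?q) * (ennreal (indicator {z. 0 < z \<bullet> e} z * norm z powr - ?q) * indicator {1<..} (z \<bullet> e)) \<partial>lborel)"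
      using a by (intro nn_integral_cong)
        (auto simp: indicator_def powr_mult ennreal_mult zero_less_mult_iff)
    also have "\<dots> = ennreal (a powr - ?q) * C"
      unfolding C_def by (subst nn_integral_cmult) (auto simp: eM)
    also have "ennreal (\<bar>a\<bar> ^ DIM('a)) * (ennreal (a powr - ?q) * C) = ennreal (a powr (- 2 * s)) * C"
    proof -
      have "\<bar>a\<bar> ^ DIM('a) * a powr - ?q = a powr (- 2 * s)"
        using a by (simp add: powr_realpow[symmetric] powr_add[symmetric])
      then show ?thesis
        by (simp add: mult.assoc[symmetric] ennreal_mult'[symmetric])
    qed
    finally show ?thesis .
  qed
  have "C \<le> (\<integral>\<^sup>+z. ennreal (indicator {z. 1 \<le> norm z} z * norm z powr - ?q) \<partial>(lborel :: 'a measure))"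
    unfolding C_def
  proof (subst eM, simp, intro nn_integral_mono)
    fix z :: 'a
    have "z \<bullet> e \<le> norm z" using Basis_le_norm[OF e, of z] by simp
    then show "ennreal (indicator {z. 0 < z \<bullet> e} z * norm z powr - ?q) * indicator {1<..} (z \<bullet> e)
       \<le> ennreal (indicator {z. 1 \<le> norm z} z * norm z powr - ?q)"
      by (auto simp: indicator_def)
  qed
  also have "\<dots> < \<infinity>" using s by (intro nn_integral_norm_powr_tail) simp
  finally have C: "C < \<infinity>" .
  then have C': "C = ennreal (enn2real C)" by (simp add: less_top)
  have tailN: "emeasure N {a<..} = ennreal (a powr (- 2 * s)) * C" if a: "a > 0" for a
  proof -
    have "emeasure N {a<..} = (\<integral>\<^sup>+t. ennreal (c * (indicator {0<..} t * t powr (- 1 - 2 * s))) * indicator {a<..} t \<partial>lborel)"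
      unfolding N_def by (subst emeasure_density) auto
    also have "\<dots> = (\<integral>\<^sup>+t. ennreal (c * t powr (- 1 - 2 * s)) * indicator {a..} t \<partial>lborel)"
    proof (intro nn_integral_cong_AE)
      show "AE t in lborel. ennreal (c * (indicator {0<..} t * t powr (- 1 - 2 * s))) * indicator {a<..} t
        = ennreal (c * t powr (- 1 - 2 * s)) * indicator {a..} t"
        using AE_lborel_singleton[of a] by eventually_elim (use a in \<open>auto simp: indicator_def\<close>)
    qed
    also have "\<dots> = ennreal (0 - (- enn2real C * a powr (- 2 * s)))"
    proof (rule nn_integral_FTC_atLeast)
      show "((\<lambda>x. - enn2real C * x powr (- 2 * s)) has_real_derivative c * x powr (- 1 - 2 * s)) (at x)" if "a \<le> x" for x
        using a that by (auto intro!: derivative_eq_intros simp: c_def powr_diff powr_minus field_simps)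
      show "((\<lambda>x. - enn2real C * x powr (- 2 * s)) \<longlongrightarrow> 0) at_top"
        using s by (intro tendsto_mult_right_zero tendsto_neg_powr) (auto simp: filterlim_ident)
    qed (use s in \<open>auto simp: c_def\<close>)
    also have "\<dots> = ennreal (a powr (- 2 * s)) * C"
      by (subst (2) C') (simp add: ennreal_mult'[symmetric] mult.commute)
    finally show ?thesis .
  qed
  \<comment> \<open>The tails a^(-2s) C may blow up as a tends to 0, so uniqueness from finite
    half-line measures is applied on (a, \<infinity>) first; the half-line is then exhausted with a
    = 1/(i+1).\<close>
  have restr: "emeasure M (A \<inter> {a<..}) = emeasure N (A \<inter> {a<..})" if a: "a > 0" and A: "A \<in> sets borel" for a A
  proof -
    let ?R = "\<lambda>M. density M (indicator {a<..} :: real \<Rightarrow> ennreal)"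
    have d: "emeasure (?R L) B = emeasure L (B \<inter> {a<..})" if "sets L = sets borel" "B \<in> sets borel" for L B
      using that by (subst emeasure_density)
        (auto simp: indicator_inter_arith[symmetric] measurable_cong_sets[OF that(1) refl] Int_commute)
    have "?R M = ?R N"
    proof (rule measure_eqI_lessThan)
      fix x
      have m: "{x<..} \<inter> {a<..} = {max x a<..}" by auto
      show "emeasure (?R M) {x<..} < \<infinity>" "emeasure (?R M) {x<..} = emeasure (?R N) {x<..}"
        using a C by (simp_all add: d sM m scale tailN ennreal_mult_eq_top_iff less_top[symmetric])
    qed (simp_all add: sM)
    then show ?thesis using d[OF sM(1) A] d[OF sM(2) A] by simp
  qed
  have "M = N"
  proof (rule measure_eqI)
    fix A assume "A \<in> sets M"
    then have A: "A \<in> sets borel" by (simp add: sM)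
    have pos: "emeasure L A = (SUP i. emeasure L (A \<inter> {1 / real (Suc i)<..}))"
      if L: "sets L = sets borel" and z: "emeasure L {..0} = 0" for L
    proof -
      have u: "(\<Union>i. A \<inter> {1 / real (Suc i)<..}) = A \<inter> {0<..}"
      proof -
        have "\<exists>i. 1 / real (Suc i) < x" if "x > 0" for x :: real
          using that reals_Archimedean[of x] by (auto simp: inverse_eq_divide)
        moreover have "x > 0" if "1 / real (Suc i) < x" for x :: real and i
          using that by (meson less_trans of_nat_0_less_iff zero_less_Suc zero_less_divide_1_iff)
        ultimately show ?thesis by auto
      qed
      have "emeasure L A = emeasure L (A \<inter> {0<..})"
      proof (rule emeasure_eq_AE)
        have "AE x in L. x \<notin> {..0}"
          using z L by (intro AE_not_in) (auto simp: null_sets_def)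
        then show "AE x in L. (x \<in> A) = (x \<in> A \<inter> {0<..})" by eventually_elim auto
      qed (use A L in auto)
      also have "\<dots> = (SUP i. emeasure L (A \<inter> {1 / real (Suc i)<..}))"
        unfolding u[symmetric]
      proof (rule SUP_emeasure_incseq[symmetric])
        show "incseq (\<lambda>i. A \<inter> {1 / real (Suc i)<..})"
        proof (rule incseq_SucI)
          fix i
          have "1 / real (Suc (Suc i)) \<le> 1 / real (Suc i)" by (intro frac_le) auto
          then show "A \<inter> {1 / real (Suc i)<..} \<subseteq> A \<inter> {1 / real (Suc (Suc i))<..}" by (auto simp del: of_nat_Suc)
        qed
        show "range (\<lambda>i. A \<inter> {1 / real (Suc i)<..}) \<subseteq> sets L"
          unfolding L using A by (intro image_subsetI sets.Int) simp_all
      qed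
      finally show ?thesis .
    qed
    have zM: "emeasure M {..0} = 0"
      by (subst eM) (auto simp: nn_integral_0_iff_AE indicator_def)
    have zN: "emeasure N {..0} = 0"
      unfolding N_def by (subst emeasure_density) (auto simp: nn_integral_0_iff_AE indicator_def)
    show "emeasure M A = emeasure N A"
      unfolding pos[OF sM(1) zM] pos[OF sM(2) zN] using restr[OF _ A] by simp
  qed (simp add: sM)
  then show ?thesis
    using that[of c] s unfolding M_def N_def c_def by simp
qed

section \<open>The positive part to the power s\<close>

definition pos_powr :: "real \<Rightarrow> real \<Rightarrow> real" where
  "pos_powr s x = max 0 x powr s"

lemma pos_powr_nonneg [simp]: "0 \<le> pos_powr s x"
  by (simp add: pos_powr_def)

lemma pos_powr_eq: "0 \<le> x \<Longrightarrow> pos_powr s x = x powr s"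
  by (simp add: pos_powr_def)

lemma pos_powr_eq_0: "x \<le> 0 \<Longrightarrow> pos_powr s x = 0"
  by (simp add: pos_powr_def)

lemma pos_powr_1 [simp]: "pos_powr s 1 = 1"
  by (simp add: pos_powr_def)

lemma pos_powr_mult: "0 \<le> c \<Longrightarrow> pos_powr s (c * x) = c powr s * pos_powr s x"
  by (cases "0 \<le> x")
    (simp_all add: pos_powr_def powr_mult max_absorb2 max_absorb1 mult_nonneg_nonpos)

lemma continuous_on_pos_powr [continuous_intros]:
  "0 < s \<Longrightarrow> continuous_on S f \<Longrightarrow> continuous_on S (\<lambda>x. pos_powr s (f x))"
  unfolding pos_powr_def by (intro continuous_on_powr' continuous_intros) auto

lemma borel_measurable_pos_powr [measurable]: "pos_powr s \<in> borel_measurable borel"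
  unfolding pos_powr_def by measurable

lemma isCont_pos_powr: "0 < s \<Longrightarrow> isCont (pos_powr s) x"
  using continuous_on_pos_powr[of s UNIV "\<lambda>x. x"] by (simp add: continuous_on_eq_continuous_at)

lemma isCont_pos_powr' [continuous_intros]: "0 < s \<Longrightarrow> isCont f x \<Longrightarrow> isCont (\<lambda>x. pos_powr s (f x)) x"
  by (rule isCont_o2[OF _ isCont_pos_powr])

text \<open>After division by a + b both terms lie in [0, 1], where x \<le> x^s.\<close>

lemma powr_subadditive:
  fixes a b s :: real
  assumes "0 \<le> a" "0 \<le> b" "0 < s" "s \<le> 1"
  shows "(a + b) powr s \<le> a powr s + b powr s"
proof (cases "a + b = 0")
  case False
  with assms have ab: "a + b > 0" by simp
  have *: "x / (a + b) \<le> x powr s / (a + b) powr s" if "0 \<le> x" "x \<le> a + b" for x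
    using powr_mono'[of s 1 "x / (a + b)"] that ab assms by (simp add: powr_divide)
  have "1 = a / (a + b) + b / (a + b)" using ab by (simp add: add_divide_distrib[symmetric])
  also have "\<dots> \<le> (a powr s + b powr s) / (a + b) powr s"
    using *[of a] *[of b] assms by (simp add: add_divide_distrib)
  finally show ?thesis using ab by (simp add: pos_le_divide_eq)
qed (use assms in auto)

lemma pos_powr_Holder:
  assumes "0 < s" "s \<le> 1"
  shows "\<bar>pos_powr s a - pos_powr s b\<bar> \<le> \<bar>a - b\<bar> powr s"
proof -
  have *: "\<bar>pos_powr s a - pos_powr s b\<bar> \<le> (a - b) powr s" if "b \<le> a" for a b
  proof -
    have mono: "pos_powr s b \<le> pos_powr s a"
      unfolding pos_powr_def using that assms by (intro powr_mono2) auto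
    have "pos_powr s a \<le> (max 0 b + (a - b)) powr s"
      unfolding pos_powr_def using that assms by (intro powr_mono2) auto
    also have "\<dots> \<le> pos_powr s b + (a - b) powr s"
      unfolding pos_powr_def using that assms by (intro powr_subadditive) auto
    finally show ?thesis using mono by simp
  qed
  show ?thesis
    using *[of a b] *[of b a] by (cases "b \<le> a") (auto simp: abs_minus_commute)
qed

text \<open>The tangent at 1 lies above a concave function; here as a case of Young's inequality.
  Added at 1 + t and 1 - t, it fixes the sign of the second difference.\<close>

lemma powr_le_linear:
  fixes x s :: real
  assumes "0 < x" "0 \<le> s" "s \<le> 1"
  shows "x powr s \<le> 1 + s * (x - 1)"
  using Youngs_inequality_0[of s "1 - s" x 1] assms by (simp add: algebra_simps)

text \<open>This is the identity saying that \<open>pos_powr s\<close> is \<open>s\<close>-harmonic on the positive half-line. With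
  primitives \<open>A\<close> and \<open>B\<close> of the two parts of the integrand, the substitution \<open>t = w / (1 - w)\<close> in
  the first one makes the difference an explicit function: \<open>A (w / (1 - w)) - B w - F w\<close> is constant.\<close>

lemma second_difference_pos_powr:
  fixes s :: real
  defines "\<kappa> \<equiv> \<lambda>t. (pos_powr s (1 + t) + pos_powr s (1 - t) - 2) * t powr (- 1 - 2 * s)"
  assumes s: "0 < s" "s < 1"
  shows "set_integrable lborel {0<..} \<kappa>" "(LINT t:{0<..}|lborel. \<kappa> t) = 0"
proof -
  define a where "a t = ((1 + t) powr s - 1) * t powr (- 1 - 2 * s)" for t
  define b where "b t = (1 - pos_powr s (1 - t)) * t powr (- 1 - 2 * s)" for t
  \<comment> \<open>Under t = w/(1-w) one has 1 + t = 1/(1-w), and the transformed \<open>a\<close>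
    minus \<open>b\<close> factors as (1 - (1-w)^s) ((1-w)^(s-1) - 1) w^(-1-2s). This is exactly the
    derivative of \<open>F\<close>.\<close>
  define F where "F w = (1 - (1 - w) powr s)\<^sup>2 * w powr (- 2 * s) / (2 * s)" for w :: real
  have \<kappa>: "\<kappa> t = a t - b t" if "t > 0" for t
    using that by (simp add: \<kappa>_def a_def b_def pos_powr_eq algebra_simps)
  have ca: "isCont a t" if "t > 0" for t
    unfolding a_def using that by (intro continuous_intros) auto
  have cb: "isCont b t" if "t > 0" for t
    unfolding b_def using that s by (intro continuous_intros) auto
  have c\<kappa>: "isCont \<kappa> t" if "t > 0" for t
    unfolding \<kappa>_def using that s by (intro continuous_intros) auto
  obtain A where A: "\<And>t. t > 0 \<Longrightarrow> (A has_real_derivative a t) (at t)"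
    using einterval_antiderivative[of 0 \<infinity> a] ca
    by (auto simp: has_real_derivative_iff_has_vector_derivative zero_ereal_def)
  obtain B where B: "\<And>t. t > 0 \<Longrightarrow> (B has_real_derivative b t) (at t)"
    using einterval_antiderivative[of 0 \<infinity> b] cb
    by (auto simp: has_real_derivative_iff_has_vector_derivative zero_ereal_def)
  define K where "K t = A t - B t" for t
  have K: "(K has_real_derivative \<kappa> t) (at t)" if "t > 0" for t
    unfolding K_def using that by (auto intro!: derivative_eq_intros A B simp: \<kappa>)
  \<comment> \<open>Base point w = 1/2, which corresponds to t = 1.\<close>
  define c where "c = A 1 - B (1/2) - F (1/2)"
  have dG: "((\<lambda>w. A (w / (1 - w)) - B w - F w) has_real_derivative 0) (at w)" if w: "0 < w" "w < 1" for w
  proof -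
    have dA: "((\<lambda>w. A (w / (1 - w))) has_real_derivative a (w / (1 - w)) * (1 / (1 - w)\<^sup>2)) (at w)"
      using w by (intro DERIV_chain2[OF A]) (auto intro!: derivative_eq_intros simp: power2_eq_square field_simps)
    have dF: "(F has_real_derivative (1 - (1 - w) powr s) * w powr (- 1 - 2 * s) * ((1 - w) powr (s - 1) - 1)) (at w)"
    proof -
      have e1: "w powr (- (2 * s)) = w * w powr (- 1 - 2 * s)"
        using w powr_add[of w 1 "- 1 - 2 * s"] by simp
      have e2: "(1 - w) powr s = (1 - w) * (1 - w) powr (s - 1)"
        using w powr_add[of "1 - w" 1 "s - 1"] by simp
      have dz: "((\<lambda>w. (1 - w) powr s) has_real_derivative - (s * (1 - w) powr (s - 1))) (at w)"
        using w by (auto intro!: derivative_eq_intros)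
      have dw: "((\<lambda>w. w powr (- 2 * s)) has_real_derivative - (2 * s) * w powr (- 1 - 2 * s)) (at w)"
      proof -
        have "- 2 * s - 1 = - 1 - 2 * s" by simp
        then show ?thesis using has_real_derivative_powr[OF w(1), of "- 2 * s"] by (simp only: mult_minus_left)
      qed
      have "(F has_real_derivative (2 * (1 - (1 - w) powr s) * (s * (1 - w) powr (s - 1)) * w powr (- (2 * s))
        + (1 - (1 - w) powr s)\<^sup>2 * (- (2 * s) * w powr (- 1 - 2 * s))) / (2 * s)) (at w)"
        unfolding F_def
        by (rule DERIV_cong, (rule DERIV_cdivide DERIV_mult DERIV_power DERIV_diff DERIV_const dz dw)+)
          (simp add: algebra_simps)
      also have "(2 * (1 - (1 - w) powr s) * (s * (1 - w) powr (s - 1)) * w powr (- (2 * s))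
        + (1 - (1 - w) powr s)\<^sup>2 * (- (2 * s) * w powr (- 1 - 2 * s))) / (2 * s)
        = (1 - (1 - w) powr s) * w powr (- 1 - 2 * s) * (w * (1 - w) powr (s - 1) - (1 - (1 - w) powr s))"
        unfolding e1 using s by (simp add: field_simps power2_eq_square)
      also have "w * (1 - w) powr (s - 1) - (1 - (1 - w) powr s) = (1 - w) powr (s - 1) - 1"
        by (subst e2) (simp add: algebra_simps)
      finally show ?thesis .
    qed
    have aw: "a (w / (1 - w)) * (1 / (1 - w)\<^sup>2) = ((1 - w) powr (s - 1) - (1 - w) powr (2 * s - 1)) * w powr (- 1 - 2 * s)"
    proof -
      have "1 + w / (1 - w) = 1 / (1 - w)" using w by (simp add: field_simps)
      then have aw1: "a (w / (1 - w)) = ((1 - w) powr - s - 1) * ((1 - w) powr (1 + 2 * s) * w powr (- 1 - 2 * s))"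
        unfolding a_def using w by (simp add: powr_divide powr_minus powr_diff powr_add field_simps)
      have aw2: "1 / (1 - w)\<^sup>2 = (1 - w) powr - 2"
        using w by (simp add: powr_minus_divide powr_numeral)
      have "((1 - w) powr - s - 1) * ((1 - w) powr (1 + 2 * s) * w powr (- 1 - 2 * s)) * (1 - w) powr - 2
        = ((1 - w) powr (- s + (1 + 2 * s) + - 2) - (1 - w) powr ((1 + 2 * s) + - 2)) * w powr (- 1 - 2 * s)"
        unfolding powr_add by (simp add: algebra_simps)
      then show ?thesis unfolding aw1 aw2 by simp
    qed
    have z: "(1 - w) powr (2 * s - 1) = (1 - w) powr s * (1 - w) powr (s - 1)"
      by (simp add: powr_add[symmetric])
    have "a (w / (1 - w)) * (1 / (1 - w)\<^sup>2) - b w - (1 - (1 - w) powr s) * w powr (- 1 - 2 * s) * ((1 - w) powr (s - 1) - 1) = 0"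
      unfolding aw z using w by (simp add: b_def pos_powr_eq algebra_simps)
    then show ?thesis
      using w by (auto intro!: derivative_eq_intros dA dF B)
  qed
  have G: "A (w / (1 - w)) = c + B w + F w" if w: "0 < w" "w < 1" for w
  proof -
    have cG: "continuous_on {x..y} (\<lambda>w. A (w / (1 - w)) - B w - F w)" if "0 < x" "y < 1" for x y
      using that by (intro continuous_at_imp_continuous_on ballI DERIV_isCont[OF dG]) auto
    have "A (w / (1 - w)) - B w - F w = A ((1/2) / (1 - 1/2)) - B (1/2) - F (1/2)"
    proof (cases w "1/2::real" rule: linorder_cases)
      case less
      show ?thesis
        by (rule DERIV_isconst_end[OF less cG dG, symmetric]) (use less w in auto)
    next
      case greater
      show ?thesis
        by (rule DERIV_isconst_end[OF greater cG dG]) (use greater w in auto)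
    next
      case equal
      show ?thesis unfolding equal ..
    qed
    then show ?thesis by (simp add: c_def)
  qed
  have AG: "A t = c + B (t / (1 + t)) + F (t / (1 + t))" if "t > 0" for t
  proof -
    have "(t / (1 + t)) / (1 - t / (1 + t)) = t" using that by (simp add: field_simps)
    moreover have "0 < t / (1 + t)" "t / (1 + t) < 1" using that by auto
    ultimately show ?thesis using G[of "t / (1 + t)"] by metis
  qed
  \<comment> \<open>This is where s < 1 enters: the numerator is at most w^2, so \<open>F\<close> is
    of order w^(2-2s).\<close>
  have F0: "(F \<longlongrightarrow> 0) (at_right 0)"
  proof (rule tendsto_sandwich[OF _ _ tendsto_const])
    have sq: "(1 - (1 - w) powr s)\<^sup>2 \<le> w\<^sup>2" if "0 < w" "w < 1" for w
    proof -
      have "1 - w \<le> (1 - w) powr s" using powr_mono'[of s 1 "1 - w"] that s by simp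
      moreover have "(1 - w) powr s \<le> 1" using that s by (simp add: powr_le1)
      ultimately show ?thesis by (intro power_mono) auto
    qed
    have "F w \<le> w powr (2 - 2 * s) / (2 * s)" if "0 < w" "w < 1" for w
    proof -
      have "F w \<le> w\<^sup>2 * w powr (- 2 * s) / (2 * s)"
        unfolding F_def using sq[OF that] s
        by (intro divide_right_mono mult_right_mono) auto
      also have "w\<^sup>2 * w powr (- 2 * s) = w powr (2 - 2 * s)"
        using that powr_add[of w 2 "- 2 * s"] by (simp add: powr_numeral)
      finally show ?thesis .
    qed
    then show "\<forall>\<^sub>F w in at_right 0. F w \<le> w powr (2 - 2 * s) / (2 * s)"
      by (auto simp: eventually_at_right_field intro!: exI[of _ 1])
    show "\<forall>\<^sub>F w in at_right 0. 0 \<le> F w"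
      using s by (intro always_eventually) (simp add: F_def)
    show "((\<lambda>w. w powr (2 - 2 * s) / (2 * s)) \<longlongrightarrow> 0) (at_right 0)"
      using s by real_asymp
  qed
  have F1: "(F \<longlongrightarrow> 1 / (2 * s)) (at_left 1)"
  proof -
    have "(F \<longlongrightarrow> (1 - 0 powr s)\<^sup>2 * 1 powr (- 2 * s) / (2 * s)) (at_left 1)"
      unfolding F_def using s
      by (intro tendsto_intros tendsto_eq_intros) (auto simp: eventually_at_filter)
    then show ?thesis by simp
  qed
  \<comment> \<open>\<open>b\<close> behaves like s t^(-2s) near 0, so \<open>B\<close> itself need
    not have a limit there when s \<ge> 1/2. Only its increment between t/(1+t) and t is estimated:
    the length is at most t^2 and the slope at most (t/2)^(-2s).\<close>
  have BB: "\<bar>B (t / (1 + t)) - B t\<bar> \<le> t * t * (t / 2) powr (- 2 * s)" if t: "0 < t" "t < 1" for t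
  proof -
    let ?w = "t / (1 + t)"
    have w: "0 < ?w" "?w < t" "t / 2 \<le> ?w" "t - ?w \<le> t * t"
      using t by (auto simp: field_simps)
    obtain \<xi> where \<xi>: "?w < \<xi>" "\<xi> < t" "B t - B ?w = (t - ?w) * b \<xi>"
      using MVT2[OF w(2), of B b] w(1) B by (meson less_le_trans)
    have "\<xi> \<in> {0<..<1}" using less_trans[OF w(1) \<xi>(1)] \<xi>(2) t by auto
    have "1 - \<xi> \<le> (1 - \<xi>) powr s" "(1 - \<xi>) powr s \<le> 1"
      using powr_mono'[of s 1 "1 - \<xi>"] \<open>\<xi> \<in> {0<..<1}\<close> s by (auto simp: powr_le1)
    then have "0 \<le> b \<xi>" "b \<xi> \<le> \<xi> * \<xi> powr (- 1 - 2 * s)"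
      using \<open>\<xi> \<in> {0<..<1}\<close> unfolding b_def
      by (auto simp: pos_powr_eq intro!: mult_right_mono)
    moreover have "\<xi> * \<xi> powr (- 1 - 2 * s) = \<xi> powr (- 2 * s)"
      using \<open>\<xi> \<in> {0<..<1}\<close> powr_add[of \<xi> 1 "- 1 - 2 * s"] by simp
    moreover have "\<xi> powr (- 2 * s) \<le> (t / 2) powr (- 2 * s)"
      using le_less_trans[OF w(3) \<xi>(1)] t s by (intro powr_mono2') auto
    ultimately have "0 \<le> b \<xi>" "b \<xi> \<le> (t / 2) powr (- 2 * s)" by auto
    then have "(t - ?w) * b \<xi> \<le> (t * t) * (t / 2) powr (- 2 * s)" "0 \<le> (t - ?w) * b \<xi>"
      using w t by (auto intro!: mult_mono)
    then show ?thesis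
      unfolding abs_minus_commute[of "B ?w"] \<xi>(3) by (simp only: abs_of_nonneg)
  qed
  have K0: "(K \<longlongrightarrow> c) (at_right 0)"
  proof -
    have "((\<lambda>t. B (t / (1 + t)) - B t) \<longlongrightarrow> 0) (at_right 0)"
    proof (rule Lim_null_comparison)
      show "\<forall>\<^sub>F t in at_right 0. norm (B (t / (1 + t)) - B t) \<le> t * t * (t / 2) powr (- 2 * s)"
        using BB by (auto simp: eventually_at_right_field intro!: exI[of _ 1])
      show "((\<lambda>t. t * t * (t / 2) powr (- 2 * s)) \<longlongrightarrow> 0) (at_right 0)"
        using s by real_asymp
    qed
    moreover have "((\<lambda>t. F (t / (1 + t))) \<longlongrightarrow> 0) (at_right 0)"
      by (rule filterlim_compose[OF F0]) real_asymp
    ultimately have "((\<lambda>t. c + F (t / (1 + t)) + (B (t / (1 + t)) - B t)) \<longlongrightarrow> c + 0 + 0) (at_right 0)"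
      by (intro tendsto_intros)
    then have "((\<lambda>t. c + F (t / (1 + t)) + (B (t / (1 + t)) - B t)) \<longlongrightarrow> c) (at_right 0)" by simp
    then show ?thesis
      by (rule Lim_transform_eventually)
        (auto simp: eventually_at_right_field K_def AG intro!: exI[of _ 1])
  qed
  \<comment> \<open>Beyond 1 the backward term \<open>pos_powr s (1 - t)\<close> vanishes, so
    \<open>b\<close> is a pure power and \<open>B\<close> is explicit.\<close>
  have Binf: "B t = B 1 + 1 / (2 * s) - t powr (- 2 * s) / (2 * s)" if "t > 1" for t
  proof -
    have "B t + t powr (- 2 * s) / (2 * s) = B 1 + 1 powr (- 2 * s) / (2 * s)"
    proof (rule DERIV_isconst_end[OF that])
      show "continuous_on {1..t} (\<lambda>t. B t + t powr (- 2 * s) / (2 * s))"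
        using s by (intro continuous_intros continuous_at_imp_continuous_on ballI DERIV_isCont[OF B]) auto
      show "((\<lambda>t. B t + t powr (- 2 * s) / (2 * s)) has_real_derivative 0) (at x)" if "1 < x" "x < t" for x
        using that s
        by (auto intro!: derivative_eq_intros B arg_cong[of _ _ "(powr) x"] simp: b_def pos_powr_eq_0)
    qed
    then show ?thesis by simp
  qed
  \<comment> \<open>The limit 1/(2s) of \<open>F\<close> at 1 cancels against the same constant in
    \<open>B\<close> at infinity, leaving the value already found at 0.\<close>
  have Kinf: "(K \<longlongrightarrow> c) at_top"
  proof -
    have "((\<lambda>t. F (t / (1 + t))) \<longlongrightarrow> 1 / (2 * s)) at_top"
      by (rule filterlim_compose[OF F1]) real_asymp
    moreover have "((\<lambda>t. B (t / (1 + t))) \<longlongrightarrow> B 1) at_top"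
    proof (rule isCont_tendsto_compose[of 1 B])
      show "isCont B 1" by (rule DERIV_isCont[OF B]) simp
      show "((\<lambda>t::real. t / (1 + t)) \<longlongrightarrow> 1) at_top" by real_asymp
    qed
    moreover have "((\<lambda>t. t powr (- 2 * s) / (2 * s)) \<longlongrightarrow> 0) at_top"
      using s by real_asymp
    ultimately have "((\<lambda>t. c + B (t / (1 + t)) + F (t / (1 + t)) - (B 1 + 1 / (2 * s) - t powr (- 2 * s) / (2 * s)))
      \<longlongrightarrow> c + B 1 + 1 / (2 * s) - (B 1 + 1 / (2 * s) - 0)) at_top"
      by (intro tendsto_intros)
    then have "((\<lambda>t. c + B (t / (1 + t)) + F (t / (1 + t)) - (B 1 + 1 / (2 * s) - t powr (- 2 * s) / (2 * s)))
      \<longlongrightarrow> c) at_top" by simp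
    then show ?thesis
      by (rule Lim_transform_eventually)
        (rule eventually_mono[OF eventually_gt_at_top[of 1]], simp add: K_def AG Binf)
  qed
  \<comment> \<open>Near 0 integrability comes from the constant sign of \<kappa>, by concavity,
    together with the finite limit of its primitive.\<close>
  have int1: "set_integrable lborel {0<..<1} \<kappa>"
  proof -
    have "set_integrable lborel (einterval 0 1) (\<lambda>t. - \<kappa> t)"
    proof (rule interval_integral_FTC_nonneg(1)[where F="\<lambda>t. - K t"])
      show "((\<lambda>t. - K t) has_real_derivative - \<kappa> t) (at t)" if "0 < ereal t" for t
        using that by (auto intro!: derivative_intros K)
      show "isCont (\<lambda>t. - \<kappa> t) t" if "0 < ereal t" for t
        using that by (intro continuous_intros c\<kappa>) auto
      have "0 \<le> - \<kappa> t" if "0 < t" "t < 1" for t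
      proof -
        have "pos_powr s (1 + t) + pos_powr s (1 - t) - 2 \<le> 0"
          using powr_le_linear[of "1 + t" s] powr_le_linear[of "1 - t" s] that s
          by (simp add: pos_powr_eq)
        then show ?thesis
          unfolding \<kappa>_def by (simp add: mult_nonpos_nonneg)
      qed
      then show "AE t in lborel. 0 < ereal t \<longrightarrow> ereal t < 1 \<longrightarrow> 0 \<le> - \<kappa> t"
        by (intro AE_I2) auto
      show "(((\<lambda>t. - K t) \<circ> real_of_ereal) \<longlongrightarrow> - c) (at_right 0)"
        unfolding zero_ereal_def by (simp add: ereal_tendsto_simps) (intro tendsto_intros K0)
      have "isCont K 1" by (rule DERIV_isCont[OF K]) simp
      then have "(K \<longlongrightarrow> K 1) (at_left 1)" by (simp add: isCont_def filterlim_at_split)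
      then show "(((\<lambda>t. - K t) \<circ> real_of_ereal) \<longlongrightarrow> - K 1) (at_left 1)"
        unfolding one_ereal_def by (simp add: ereal_tendsto_simps) (intro tendsto_intros)
    qed simp
    then show ?thesis
      unfolding zero_ereal_def one_ereal_def by (simp add: einterval_eq set_integrable_def)
  qed
  \<comment> \<open>Beyond 1 the bracket is at most 2 t^s in absolute value, which leaves an
    integrable t^(-1-s).\<close>
  have int2: "set_integrable lborel {1..} \<kappa>"
  proof -
    have "set_integrable lborel {1..} (\<lambda>t. 2 * t powr (- 1 - s))"
    proof -
      have "integrable lborel (\<lambda>t::real. indicator {z. 1 \<le> norm z} t * norm t powr - (1 + s))"
        using s by (intro integrable_norm_powr_tail) auto
      then have "integrable lborel (\<lambda>t::real. 2 * (indicator {1..} t *\<^sub>R (indicator {z. 1 \<le> norm z} t * norm t powr - (1 + s))))"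
        by (intro integrable_mult_right integrable_mult_indicator) auto
      also have "(\<lambda>t::real. 2 * (indicator {1..} t *\<^sub>R (indicator {z. 1 \<le> norm z} t * norm t powr - (1 + s))))
        = (\<lambda>t. indicator {1..} t *\<^sub>R (2 * t powr (- 1 - s)))"
        by (auto simp: fun_eq_iff indicator_def)
      finally show ?thesis unfolding set_integrable_def .
    qed
    then show ?thesis
      unfolding set_integrable_def
    proof (rule Bochner_Integration.integrable_bound)
      show "AE t in lborel. norm (indicator {1..} t *\<^sub>R \<kappa> t) \<le> norm (indicator {1..} t *\<^sub>R (2 * t powr (- 1 - s)))"
      proof (rule AE_I2)
        fix t :: real
        show "norm (indicator {1..} t *\<^sub>R \<kappa> t) \<le> norm (indicator {1..} t *\<^sub>R (2 * t powr (- 1 - s)))"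
        proof (cases "1 \<le> t")
          case True
          have 1: "1 \<le> t powr s" using True s by (simp add: ge_one_powr_ge_zero)
          have "(1 + t) powr s \<le> 1 + t powr s" using powr_subadditive[of 1 t s] True s by simp
          moreover have "1 \<le> (1 + t) powr s" using True s by (simp add: ge_one_powr_ge_zero)
          ultimately have "\<bar>(1 + t) powr s - 2\<bar> \<le> 2 * t powr s" using 1 by linarith
          then have "\<bar>(1 + t) powr s - 2\<bar> * t powr (- 1 - 2 * s) \<le> 2 * t powr s * t powr (- 1 - 2 * s)"
            by (intro mult_right_mono) auto
          also have "\<dots> = 2 * t powr (- 1 - s)"
            by (simp add: mult.assoc powr_add[symmetric], rule arg_cong[of _ _ "(powr) t"]) simp
          finally show ?thesis
            using True by (simp add: \<kappa>_def pos_powr_eq pos_powr_eq_0 abs_mult)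
        qed simp
      qed
    qed (simp add: \<kappa>_def)
  qed
  have "set_integrable lborel ({0<..<1} \<union> {1..}) \<kappa>"
    by (intro set_integrable_Un int1 int2) auto
  also have "{0<..<1} \<union> {1..} = {0::real<..}" by auto
  finally show int: "set_integrable lborel {0<..} \<kappa>" .
  have ei: "einterval 0 \<infinity> = {0<..}" unfolding zero_ereal_def by (auto simp: einterval_def)
  have "(LBINT t=0..\<infinity>. \<kappa> t) = c - c"
  proof (rule interval_integral_FTC_integrable)
    show "(K has_vector_derivative \<kappa> t) (at t)" if "0 < ereal t" for t
      using that K[of t] by (simp add: has_real_derivative_iff_has_vector_derivative)
    show "isCont \<kappa> t" if "0 < ereal t" for t
      using that by (intro c\<kappa>) auto
    show "((K \<circ> real_of_ereal) \<longlongrightarrow> c) (at_right 0)"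
      unfolding zero_ereal_def using K0 by (simp add: ereal_tendsto_simps)
    show "((K \<circ> real_of_ereal) \<longlongrightarrow> c) (at_left \<infinity>)"
      using Kinf by (simp add: ereal_tendsto_simps)
  qed (use int ei in auto)
  then show "(LINT t:{0<..}|lborel. \<kappa> t) = 0"
    by (simp add: interval_lebesgue_integral_def ei)
qed

section \<open>Truncated integrals of the kernel\<close>

lemma integral_dominated_convergence_at_right:
  fixes S :: "real \<Rightarrow> 'b \<Rightarrow> real"
  assumes m: "f \<in> borel_measurable M" "\<And>r. S r \<in> borel_measurable M" "integrable M W"
    and lim: "AE x in M. ((\<lambda>r. S r x) \<longlongrightarrow> f x) (at_right 0)"
    and bound: "\<And>r. 0 < r \<Longrightarrow> AE x in M. norm (S r x) \<le> W x"
  shows "((\<lambda>r. \<integral>x. S r x \<partial>M) \<longlongrightarrow> (\<integral>x. f x \<partial>M)) (at_right 0)"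
  unfolding filterlim_at_right_to_top
proof (rule integral_dominated_convergence_at_top[OF m(1) m(2) m(3)])
  show "\<forall>\<^sub>F r in at_top. AE x in M. norm (S (inverse r) x) \<le> W x"
    by (rule eventually_mono[OF eventually_gt_at_top[of 0]]) (use bound in auto)
  show "AE x in M. ((\<lambda>r. S (inverse r) x) \<longlongrightarrow> f x) at_top"
    using lim by (simp add: filterlim_at_right_to_top)
qed

lemma tendsto_indicator_norm:
  assumes "z \<noteq> 0 \<or> X = 0"
  shows "((\<lambda>r. indicator {z. r < norm z} z * X) \<longlongrightarrow> (X::real)) (at_right 0)"
proof (cases "z = 0")
  case False
  show ?thesis
    by (rule Lim_transform_eventually[OF tendsto_const])
      (use False in \<open>auto simp: eventually_at_right_field indicator_def intro!: exI[of _ "norm z"]\<close>)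
qed (use assms in auto)

locale frac_kernel =
  fixes s :: real and e :: "'a::euclidean_space"
  assumes s: "0 < s" "s < 1" and e: "e \<in> Basis"
begin

definition kernel :: "'a \<Rightarrow> real" where
  "kernel z = norm z powr - (real DIM('a) + 2 * s)"

lemma kernel_nonneg [simp]: "0 \<le> kernel z"
  by (simp add: kernel_def)

lemma kernel_minus [simp]: "kernel (- z) = kernel z"
  by (simp add: kernel_def)

lemma kernel_scale: "0 < c \<Longrightarrow> kernel (c *\<^sub>R z) = c powr - (real DIM('a) + 2 * s) * kernel z"
  by (simp add: kernel_def powr_mult)

lemma borel_measurable_kernel [measurable]: "kernel \<in> borel_measurable borel"
  unfolding kernel_def by measurable

text \<open>Up to the constant, the truncated (-\<Delta>)^s of the negative profile at a point with
  coordinate \<open>y\<close>; this explains the order of the difference.\<close>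

definition trunc :: "real \<Rightarrow> real \<Rightarrow> real" where
  "trunc r y = (\<integral>z. indicator {z. r < norm z} z * ((pos_powr s (y + z \<bullet> e) - pos_powr s y) * kernel z) \<partial>lborel)"

lemma borel_measurable_trunc [measurable]: "trunc r \<in> borel_measurable borel"
  unfolding trunc_def by measurable

text \<open>The exponent is n + 2s, from the kernel, lowered by the s gained from Hoelder continuity
  of the profile.\<close>

abbreviation tail :: "real \<Rightarrow> 'a \<Rightarrow> real" where
  "tail r z \<equiv> indicator {z. r \<le> norm z} z * norm z powr - (real DIM('a) + s)"

lemma integrable_tail: "0 < r \<Longrightarrow> integrable lborel (tail r)"
  using s by (intro integrable_norm_powr_tail) auto

lemma abs_inner_e: "\<bar>z \<bullet> e\<bar> \<le> norm z"
  using Basis_le_norm[OF e] .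

lemma norm_powr_kernel: "norm z powr s * kernel z = norm z powr - (real DIM('a) + s)"
  by (simp add: kernel_def powr_add[symmetric], rule arg_cong[of _ _ "(powr) (norm z)"]) simp

lemma increment_bound:
  "\<bar>(pos_powr s (y + z \<bullet> e) - pos_powr s y) * kernel z\<bar> \<le> norm z powr - (real DIM('a) + s)"
proof -
  have "\<bar>pos_powr s (y + z \<bullet> e) - pos_powr s y\<bar> \<le> \<bar>z \<bullet> e\<bar> powr s"
    using pos_powr_Holder[of s "y + z \<bullet> e" y] s by simp
  also have "\<dots> \<le> norm z powr s"
    using abs_inner_e s by (intro powr_mono2) auto
  finally have "\<bar>pos_powr s (y + z \<bullet> e) - pos_powr s y\<bar> * kernel z \<le> norm z powr s * kernel z"
    by (intro mult_right_mono) auto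
  then show ?thesis
    by (simp add: abs_mult norm_powr_kernel)
qed

lemma integrable_trunc:
  assumes "0 < r"
  shows "integrable lborel (\<lambda>z. indicator {z. r < norm z} z * ((pos_powr s (y + z \<bullet> e) - pos_powr s y) * kernel z))"
  by (rule Bochner_Integration.integrable_bound[OF integrable_tail[OF assms]])
    (use increment_bound[of y] in \<open>auto simp: indicator_def intro!: AE_I2\<close>)

text \<open>Count of degrees under z = y z': s from the profile, -(n + 2s) from the kernel and n
  from the volume give -s.\<close>

lemma trunc_scale:
  assumes "0 < y"
  shows "trunc r y = y powr - s * trunc (r / y) 1"
proof -
  have "trunc r y = \<bar>y\<bar> ^ DIM('a) * (\<integral>z. indicator {z. r < norm z} (0 + y *\<^sub>R z)
      * ((pos_powr s (y + (0 + y *\<^sub>R z) \<bullet> e) - pos_powr s y) * kernel (0 + y *\<^sub>R z)) \<partial>lborel)"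
    unfolding trunc_def using assms by (intro integral_lborel_affine) auto
  also have "(\<lambda>z. indicator {z. r < norm z} (0 + y *\<^sub>R z)
      * ((pos_powr s (y + (0 + y *\<^sub>R z) \<bullet> e) - pos_powr s y) * kernel (0 + y *\<^sub>R z)))
    = (\<lambda>z. (y powr s * y powr - (real DIM('a) + 2 * s)) *
        (indicator {z. r / y < norm z} z * ((pos_powr s (1 + z \<bullet> e) - pos_powr s 1) * kernel z)))"
  proof
    fix z
    have "pos_powr s (y + y * (z \<bullet> e)) = y powr s * pos_powr s (1 + z \<bullet> e)"
      using pos_powr_mult[of y s "1 + z \<bullet> e"] assms by (simp add: algebra_simps)
    moreover have "pos_powr s y = y powr s * pos_powr s 1"
      using assms by (simp add: pos_powr_eq)
    moreover have "r < y * norm z \<longleftrightarrow> r / y < norm z"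
      using assms by (simp add: pos_divide_less_eq mult.commute)
    ultimately show "indicator {z. r < norm z} (0 + y *\<^sub>R z)
      * ((pos_powr s (y + (0 + y *\<^sub>R z) \<bullet> e) - pos_powr s y) * kernel (0 + y *\<^sub>R z))
      = (y powr s * y powr - (real DIM('a) + 2 * s)) *
        (indicator {z. r / y < norm z} z * ((pos_powr s (1 + z \<bullet> e) - pos_powr s 1) * kernel z))"
      using assms by (simp add: kernel_scale indicator_def algebra_simps)
  qed
  also have "\<bar>y\<bar> ^ DIM('a) * (\<integral>z. (y powr s * y powr - (real DIM('a) + 2 * s)) *
        (indicator {z. r / y < norm z} z * ((pos_powr s (1 + z \<bullet> e) - pos_powr s 1) * kernel z)) \<partial>lborel)
     = (y ^ DIM('a) * (y powr s * y powr - (real DIM('a) + 2 * s))) * trunc (r / y) 1"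
    unfolding trunc_def integral_mult_right_zero using assms by simp
  also have "y ^ DIM('a) * (y powr s * y powr - (real DIM('a) + 2 * s)) = y powr - s"
    using assms by (simp add: powr_realpow[symmetric] powr_add[symmetric])
  finally show ?thesis .
qed

text \<open>Pushing the kernel on the half-space \<open>z \<bullet> e > 0\<close> forward to the
  coordinate reduces both claims to the one-dimensional identity.\<close>

lemma second_difference_kernel:
  defines "f \<equiv> \<lambda>t. pos_powr s (1 + t) + pos_powr s (1 - t) - 2"
  shows "integrable lborel (\<lambda>z. f (z \<bullet> e) * kernel z)"
    and "(\<integral>z. f (z \<bullet> e) * kernel z \<partial>lborel) = 0"
proof -
  have [measurable]: "f \<in> borel_measurable borel" unfolding f_def by measurable
  obtain c where c: "c \<ge> 0"
    "distr (density lborel (\<lambda>z. ennreal (indicator {z. 0 < z \<bullet> e} z * kernel z))) borel (\<lambda>z. z \<bullet> e)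
      = density lborel (\<lambda>t::real. ennreal (c * (indicator {0<..} t * t powr (- 1 - 2 * s))))"
    by (rule distr_norm_powr_inner[OF e s(1), folded kernel_def])
  let ?D = "density lborel (\<lambda>z. ennreal (indicator {z. 0 < z \<bullet> e} z * kernel z))"
  let ?E = "density lborel (\<lambda>t::real. ennreal (c * (indicator {0<..} t * t powr (- 1 - 2 * s))))"
  define P where "P z = indicator {z. 0 < z \<bullet> e} z * kernel z * f (z \<bullet> e)" for z
  have [measurable]: "P \<in> borel_measurable borel" unfolding P_def by measurable
  have eq: "c * (indicator {0<..} t * t powr (- 1 - 2 * s)) * f t
      = c * (indicator {0<..} t *\<^sub>R ((pos_powr s (1 + t) + pos_powr s (1 - t) - 2) * t powr (- 1 - 2 * s)))" for t
    by (simp add: f_def)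
  have intE: "integrable ?E f" "(\<integral>t. f t \<partial>?E) = 0"
  proof -
    have "integrable lborel (\<lambda>t. c * (indicator {0<..} t * t powr (- 1 - 2 * s)) * f t)"
      unfolding eq using second_difference_pos_powr(1)[OF s] unfolding set_integrable_def by simp
    then show "integrable ?E f"
      using c(1) by (subst integrable_density) auto
    have "(\<integral>t. f t \<partial>?E) = (\<integral>t. c * (indicator {0<..} t * t powr (- 1 - 2 * s)) * f t \<partial>lborel)"
      using c(1) by (subst integral_density) auto
    also have "\<dots> = c * 0"
      unfolding eq integral_mult_right_zero using second_difference_pos_powr(2)[OF s]
      unfolding set_lebesgue_integral_def by simp
    finally show "(\<integral>t. f t \<partial>?E) = 0" by simp
  qed
  have "integrable ?D (\<lambda>z. f (z \<bullet> e))"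
    using intE(1) unfolding c(2)[symmetric] by (subst (asm) integrable_distr_eq) auto
  then have P: "integrable lborel P"
    unfolding P_def by (subst (asm) integrable_density) auto
  have "(\<integral>z. f (z \<bullet> e) \<partial>?D) = 0"
    using intE(2) unfolding c(2)[symmetric] by (subst (asm) integral_distr) auto
  then have P0: "(\<integral>z. P z \<partial>lborel) = 0"
    unfolding P_def by (subst (asm) integral_density) auto
  have "integrable lborel (\<lambda>z. P (0 + (-1) *\<^sub>R z))"
    using P by (subst integrable_lborel_affine) auto
  then have Q: "integrable lborel (\<lambda>z. P (- z))" by simp
  have Q0: "(\<integral>z. P (- z) \<partial>lborel) = 0"
    using integral_lborel_affine[of "-1" P 0] P0 by simp
  \<comment> \<open>\<open>f\<close> is even, so reflection supplies the other half-space; on the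
    hyperplane between them \<open>f 0 = 0\<close>.\<close>
  have PQ: "f (z \<bullet> e) * kernel z = P z + P (- z)" for z
    by (cases "z \<bullet> e" "0::real" rule: linorder_cases) (auto simp: P_def f_def)
  show "integrable lborel (\<lambda>z. f (z \<bullet> e) * kernel z)"
    unfolding PQ using P Q by simp
  show "(\<integral>z. f (z \<bullet> e) * kernel z \<partial>lborel) = 0"
    unfolding PQ using P Q P0 Q0 by simp
qed

text \<open>The truncation region is symmetric, so averaging z and -z replaces first differences by
  half the second difference, which is absolutely integrable with integral 0. This gives a bound
  uniform in r and the limit by dominated convergence.\<close>

lemma trunc_1:
  obtains C where "\<And>r. 0 < r \<Longrightarrow> \<bar>trunc r 1\<bar> \<le> C" "((\<lambda>r. trunc r 1) \<longlongrightarrow> 0) (at_right 0)"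
proof -
  define f where "f t = pos_powr s (1 + t) + pos_powr s (1 - t) - 2" for t
  have [measurable]: "f \<in> borel_measurable borel" unfolding f_def by measurable
  have fi: "integrable lborel (\<lambda>z. f (z \<bullet> e) * kernel z)" "(\<integral>z. f (z \<bullet> e) * kernel z \<partial>lborel) = 0"
    using second_difference_kernel unfolding f_def by simp_all
  have sym: "trunc r 1 = (\<integral>z. indicator {z. r < norm z} z * (f (z \<bullet> e) * kernel z) \<partial>lborel) / 2" if r: "0 < r" for r
  proof -
    define g where "g z = indicator {z. r < norm z} z * ((pos_powr s (1 + z \<bullet> e) - pos_powr s 1) * kernel z)" for z
    have [measurable]: "g \<in> borel_measurable borel" unfolding g_def by measurable
    have g: "integrable lborel g" unfolding g_def by (rule integrable_trunc[OF r])
    have g': "integrable lborel (\<lambda>z. g (- z))"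
      using integrable_lborel_affine[of "-1" g 0] g by simp
    have "trunc r 1 = (\<integral>z. g z \<partial>lborel)" unfolding trunc_def g_def ..
    moreover have "(\<integral>z. g z \<partial>lborel) = (\<integral>z. g (- z) \<partial>lborel)"
      using integral_lborel_affine[of "-1" g 0] by simp
    ultimately have "2 * trunc r 1 = (\<integral>z. g z + g (- z) \<partial>lborel)"
      using g g' by simp
    also have "(\<lambda>z. g z + g (- z)) = (\<lambda>z. indicator {z. r < norm z} z * (f (z \<bullet> e) * kernel z))"
      by (auto simp: fun_eq_iff g_def f_def indicator_def algebra_simps)
    finally show ?thesis by simp
  qed
  show ?thesis
  proof (rule that[of "(\<integral>z. \<bar>f (z \<bullet> e) * kernel z\<bar> \<partial>lborel) / 2"])
    fix r :: real assume r: "0 < r"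
    have "\<bar>\<integral>z. indicator {z. r < norm z} z * (f (z \<bullet> e) * kernel z) \<partial>lborel\<bar>
      \<le> (\<integral>z. \<bar>f (z \<bullet> e) * kernel z\<bar> \<partial>lborel)"
    proof (rule integral_abs_bound_integral)
      show "integrable lborel (\<lambda>z. indicator {z. r < norm z} z * (f (z \<bullet> e) * kernel z))"
        by (rule Bochner_Integration.integrable_bound[OF fi(1)]) (auto simp: indicator_def)
    qed (use fi in \<open>auto simp: indicator_def\<close>)
    then show "\<bar>trunc r 1\<bar> \<le> (\<integral>z. \<bar>f (z \<bullet> e) * kernel z\<bar> \<partial>lborel) / 2"
      by (simp add: sym[OF r])
  next
    have "((\<lambda>r. \<integral>z. indicator {z. r < norm z} z * (f (z \<bullet> e) * kernel z) \<partial>lborel)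
      \<longlongrightarrow> (\<integral>z. f (z \<bullet> e) * kernel z \<partial>lborel)) (at_right 0)"
    proof (rule integral_dominated_convergence_at_right)
      show "integrable lborel (\<lambda>z. \<bar>f (z \<bullet> e) * kernel z\<bar>)" using fi by simp
      show "AE z in lborel. ((\<lambda>r. indicator {z. r < norm z} z * (f (z \<bullet> e) * kernel z)) \<longlongrightarrow> f (z \<bullet> e) * kernel z) (at_right 0)"
        by (intro AE_I2 tendsto_indicator_norm) (auto simp: kernel_def)
    qed (auto simp: indicator_def intro!: AE_I2)
    then have "((\<lambda>r. (\<integral>z. indicator {z. r < norm z} z * (f (z \<bullet> e) * kernel z) \<partial>lborel) / 2) \<longlongrightarrow> 0 / 2) (at_right 0)"
      unfolding fi(2) by (intro tendsto_intros) auto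
    then show "((\<lambda>r. trunc r 1) \<longlongrightarrow> 0) (at_right 0)"
      by (simp, elim Lim_transform_eventually) (auto simp: eventually_at_filter sym)
  qed
qed

text \<open>The value at 0 is a convention: \<open>trunc r 0\<close> diverges as r tends to 0, but a
  single point is invisible to the average over \<open>t\<close>. For positive \<open>y\<close> the
  value 0 expresses s-harmonicity.\<close>

definition limit :: "real \<Rightarrow> real" where
  "limit y = (if y < 0 then \<integral>z. pos_powr s (y + z \<bullet> e) * kernel z \<partial>lborel else 0)"

lemma borel_measurable_limit [measurable]: "limit \<in> borel_measurable borel"
  unfolding limit_def by measurable

lemma limit_nonneg: "0 \<le> limit y"
  by (auto simp: limit_def intro!: integral_nonneg_AE)

text \<open>The profile vanishes at \<open>y\<close>, and \<open>y + z \<bullet> e\<close> can be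
  positive only if |z| exceeds |y|. The integrand thus stays away from the singularity of the
  kernel, and scaling the tail integral yields the power of |y|.\<close>

lemma trunc_neg:
  assumes y: "y < 0"
  shows "0 < r \<Longrightarrow> \<bar>trunc r y\<bar> \<le> \<bar>y\<bar> powr - s * (\<integral>z. tail 1 z \<partial>lborel)"
    and "((\<lambda>r. trunc r y) \<longlongrightarrow> limit y) (at_right 0)"
proof -
  have bound: "pos_powr s (y + z \<bullet> e) * kernel z \<le> tail \<bar>y\<bar> z" for z
  proof (cases "\<bar>y\<bar> \<le> norm z")
    case True
    then show ?thesis
      using increment_bound[of y z] y by (auto simp: pos_powr_eq_0)
  next
    case False
    then have "y + z \<bullet> e \<le> 0" using abs_inner_e[of z] y by linarith
    then show ?thesis by (simp add: pos_powr_eq_0)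
  qed
  have tail_y: "(\<integral>z. tail \<bar>y\<bar> z \<partial>lborel) = \<bar>y\<bar> powr - s * (\<integral>z. tail 1 z \<partial>lborel)"
    using integral_norm_powr_tail[of "\<bar>y\<bar>" "real DIM('a) + s", where ?'a='a] y by simp
  have trunc_y: "trunc r y = (\<integral>z. indicator {z. r < norm z} z * (pos_powr s (y + z \<bullet> e) * kernel z) \<partial>lborel)" for r
    using y by (simp add: trunc_def pos_powr_eq_0)
  have itail: "integrable lborel (tail \<bar>y\<bar>)" using y by (intro integrable_tail) simp
  have bound': "\<bar>indicator {z. r < norm z} z * (pos_powr s (y + z \<bullet> e) * kernel z)\<bar> \<le> tail \<bar>y\<bar> z" for r z
    using bound[of z] by (auto simp: indicator_def split: if_splits)
  show "\<bar>trunc r y\<bar> \<le> \<bar>y\<bar> powr - s * (\<integral>z. tail 1 z \<partial>lborel)" if "0 < r"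
    unfolding tail_y[symmetric] trunc_y
    using integrable_trunc[OF that, of y] y bound' itail
    by (intro integral_abs_bound_integral) (auto simp: pos_powr_eq_0)
  have "((\<lambda>r. trunc r y) \<longlongrightarrow> (\<integral>z. pos_powr s (y + z \<bullet> e) * kernel z \<partial>lborel)) (at_right 0)"
    unfolding trunc_y
  proof (rule integral_dominated_convergence_at_right[OF _ _ itail])
    show "AE z in lborel. ((\<lambda>r. indicator {z. r < norm z} z * (pos_powr s (y + z \<bullet> e) * kernel z))
      \<longlongrightarrow> pos_powr s (y + z \<bullet> e) * kernel z) (at_right 0)"
      by (intro AE_I2 tendsto_indicator_norm) (auto simp: kernel_def)
  qed (use bound' in auto)
  then show "((\<lambda>r. trunc r y) \<longlongrightarrow> limit y) (at_right 0)"
    using y by (simp add: limit_def)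
qed

lemma trunc_bound_and_limit:
  obtains C where "\<And>r y. 0 < r \<Longrightarrow> y \<noteq> 0 \<Longrightarrow> \<bar>trunc r y\<bar> \<le> C * \<bar>y\<bar> powr - s"
    "\<And>y. y \<noteq> 0 \<Longrightarrow> ((\<lambda>r. trunc r y) \<longlongrightarrow> limit y) (at_right 0)"
proof -
  obtain C where C: "\<And>r. 0 < r \<Longrightarrow> \<bar>trunc r 1\<bar> \<le> C" "((\<lambda>r. trunc r 1) \<longlongrightarrow> 0) (at_right 0)"
    using trunc_1 by blast
  let ?K = "\<integral>z. tail 1 z \<partial>lborel"
  have "\<bar>trunc r y\<bar> \<le> max C ?K * \<bar>y\<bar> powr - s" if "0 < r" "y \<noteq> 0" for r y
  proof (cases "y < 0")
    case True
    have "\<bar>trunc r y\<bar> \<le> ?K * \<bar>y\<bar> powr - s"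
      using trunc_neg(1)[OF True that(1)] by (simp add: mult.commute)
    also have "\<dots> \<le> max C ?K * \<bar>y\<bar> powr - s" by (intro mult_right_mono) auto
    finally show ?thesis .
  next
    case False
    then have y: "y > 0" using that by simp
    have "\<bar>trunc r y\<bar> = \<bar>trunc (r / y) 1\<bar> * \<bar>y\<bar> powr - s"
      using y by (simp add: trunc_scale[OF y] abs_mult)
    also have "\<dots> \<le> max C ?K * \<bar>y\<bar> powr - s"
      using C(1)[of "r / y"] y that by (intro mult_right_mono) auto
    finally show ?thesis .
  qed
  moreover have "((\<lambda>r. trunc r y) \<longlongrightarrow> limit y) (at_right 0)" if "y \<noteq> 0" for y
  proof (cases "y < 0")
    case False
    then have y: "y > 0" using that by simp
    have "filterlim (\<lambda>r. r / y) (at_right 0) (at_right 0)"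
      using y by (auto simp: filterlim_at eventually_at_filter intro!: tendsto_eq_intros)
    then have "((\<lambda>r. y powr - s * trunc (r / y) 1) \<longlongrightarrow> y powr - s * 0) (at_right 0)"
      by (intro tendsto_intros filterlim_compose[OF C(2)])
    then show ?thesis
      using y by (simp add: trunc_scale[OF y] limit_def)
  qed (rule trunc_neg(2))
  ultimately show ?thesis using that by blast
qed

end

section \<open>The fractional Laplacian of the averaged profile\<close>

lemma integrable_abs_powr_interval:
  fixes s a :: real
  assumes s: "0 < s" "s < 1"
  shows "integrable lborel (\<lambda>t. indicator {b..c} t * \<bar>a - t\<bar> powr - s)"
proof -
  define R where "R = \<bar>a\<bar> + \<bar>b\<bar> + \<bar>c\<bar>"
  have "R \<ge> 0" by (simp add: R_def)
  define P where "P v = indicator {0..R} v * v powr - s" for v :: real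
  have [measurable]: "P \<in> borel_measurable borel" unfolding P_def by measurable
  have "(\<lambda>v. v powr - s) integrable_on {0..R}"
    using s \<open>R \<ge> 0\<close> by (intro integrable_on_powr_from_0) auto
  then have "(\<lambda>v. v powr - s) absolutely_integrable_on {0..R}"
    by (intro nonnegative_absolutely_integrable_1) auto
  then have "integrable lebesgue P"
    by (simp add: set_integrable_def P_def[abs_def])
  then have P: "integrable lborel P"
    by (simp add: integrable_completion)
  \<comment> \<open>The one-sided singularity \<open>P\<close> is placed on either side of
    \<open>a\<close>; the radius \<open>R\<close> bounds |a - t| on the whole interval.\<close>
  have "integrable lborel (\<lambda>t. P (a + (-1) *\<^sub>R t))" "integrable lborel (\<lambda>t. P (- a + 1 *\<^sub>R t))"
    using P by (subst integrable_lborel_affine; simp)+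
  then have "integrable lborel (\<lambda>t. P (a - t) + P (t - a))"
    by (simp add: algebra_simps)
  then show ?thesis
  proof (rule Bochner_Integration.integrable_bound)
    show "AE t in lborel. norm (indicator {b..c} t * \<bar>a - t\<bar> powr - s) \<le> norm (P (a - t) + P (t - a))"
    proof (rule AE_I2)
      fix t
      have "\<bar>a - t\<bar> \<le> R" if "b \<le> t" "t \<le> c" using that unfolding R_def by linarith
      then show "norm (indicator {b..c} t * \<bar>a - t\<bar> powr - s) \<le> norm (P (a - t) + P (t - a))"
        by (cases "t \<le> a") (auto simp: indicator_def P_def abs_minus_commute)
    qed
  qed simp
qed

definition potential :: "real \<Rightarrow> (real \<Rightarrow> real) \<Rightarrow> real \<Rightarrow> real" where
  "potential s \<rho> x = (\<integral>t. \<rho> t * pos_powr s (x - t) \<partial>lborel)"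

context frac_kernel begin

text \<open>The truncated integral is averaged over \<open>t\<close> before letting \<open>r\<close> tend to 0; the bound
  \<open>\<bar>trunc r y\<bar> \<le> C * \<bar>y\<bar> powr - s\<close> has an integrable singularity, so no regularity of the potential is needed.\<close>

lemma has_frac_laplacian_potential:
  assumes \<rho>: "continuous_on UNIV \<rho>" "\<And>t. 0 \<le> \<rho> t" "\<And>t. t \<notin> {-1..0} \<Longrightarrow> \<rho> t = 0"
  shows "has_frac_laplacian s (\<lambda>x. - potential s \<rho> (x \<bullet> e))
    (frac_laplacian_const DIM('a) s * (\<integral>t. \<rho> t * limit (x \<bullet> e - t) \<partial>lborel)) x"
proof -
  have [measurable]: "\<rho> \<in> borel_measurable borel" by (rule borel_measurable_continuous_onI[OF \<rho>(1)])
  have [measurable]: "potential s \<rho> \<in> borel_measurable borel" unfolding potential_def by measurable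
  have "bounded (\<rho> ` {-1..0})"
    by (intro compact_imp_bounded compact_continuous_image continuous_on_subset[OF \<rho>(1)]) auto
  then obtain M where M: "M > 0" "\<And>t. t \<in> {-1..0} \<Longrightarrow> \<bar>\<rho> t\<bar> \<le> M"
    unfolding bounded_pos by auto
  have \<rho>M: "\<rho> t \<le> M * indicator {-1..0} t" for t
    using M(2)[of t] \<rho>(3)[of t] by (auto simp: indicator_def)
  have i\<rho>: "integrable lborel \<rho>"
  proof (rule Bochner_Integration.integrable_bound)
    show "integrable lborel (\<lambda>t::real. M * indicator {-1..0} t)"
      by (simp add: integrable_indicator_iff)
    show "AE t in lborel. norm (\<rho> t) \<le> norm (M * indicator {-1..0} t)"
      using \<rho>M \<rho>(2) M(1) by (intro AE_I2) (auto simp: abs_mult)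
  qed simp
  have ipot: "integrable lborel (\<lambda>t. \<rho> t * pos_powr s (y - t))" for y
  proof (rule Bochner_Integration.integrable_bound)
    show "integrable lborel (\<lambda>t. (\<bar>y\<bar> + 1) powr s * \<rho> t)" using i\<rho> by simp
    have "\<rho> t * pos_powr s (y - t) \<le> (\<bar>y\<bar> + 1) powr s * \<rho> t" for t
    proof (cases "t \<in> {-1..0}")
      case True
      then have "pos_powr s (y - t) \<le> (\<bar>y\<bar> + 1) powr s"
        unfolding pos_powr_def using s by (intro powr_mono2) auto
      then show ?thesis using \<rho>(2)[of t] by (metis mult.commute mult_left_mono)
    qed (simp add: \<rho>(3))
    then show "AE t in lborel. norm (\<rho> t * pos_powr s (y - t)) \<le> norm ((\<bar>y\<bar> + 1) powr s * \<rho> t)"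
      using \<rho>(2) by (intro AE_I2) (simp add: abs_mult)
  qed simp
  have pot_diff: "potential s \<rho> a - potential s \<rho> b = (\<integral>t. \<rho> t * (pos_powr s (a - t) - pos_powr s (b - t)) \<partial>lborel)" for a b
    unfolding potential_def right_diff_distrib by (rule Bochner_Integration.integral_diff[OF ipot ipot, symmetric])
  define m where "m = (\<integral>t. \<rho> t \<partial>lborel)"
  have Holder: "\<bar>potential s \<rho> a - potential s \<rho> b\<bar> \<le> \<bar>a - b\<bar> powr s * m" for a b
  proof -
    have "\<bar>potential s \<rho> a - potential s \<rho> b\<bar> \<le> (\<integral>t. \<bar>a - b\<bar> powr s * \<rho> t \<partial>lborel)"
      unfolding pot_diff
    proof (rule integral_abs_bound_integral)
      show "integrable lborel (\<lambda>t. \<rho> t * (pos_powr s (a - t) - pos_powr s (b - t)))"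
        unfolding right_diff_distrib by (rule Bochner_Integration.integrable_diff[OF ipot ipot])
      show "\<bar>\<rho> t * (pos_powr s (a - t) - pos_powr s (b - t))\<bar> \<le> \<bar>a - b\<bar> powr s * \<rho> t" for t
        using pos_powr_Holder[of s "a - t" "b - t"] s \<rho>(2)[of t]
        by (simp add: abs_mult mult.commute[of "\<bar>a - b\<bar> powr s"] mult_left_mono)
    qed (use i\<rho> in auto)
    then show ?thesis by (simp add: m_def)
  qed
  have m: "m \<ge> 0" unfolding m_def using \<rho>(2) by (intro integral_nonneg_AE) auto
  let ?q = "real DIM('a) + 2 * s"
  \<comment> \<open>The potential inherits Hoelder exponent s, so it grows at most like |y|^s;
    against the weight of order n + 2s this leaves the integrable order n + s. The unit ball is
    split off because \<open>tail 1\<close> starts at radius 1.\<close>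
  have weight: "integrable lborel (\<lambda>y::'a. - potential s \<rho> (y \<bullet> e) / (1 + norm y) powr ?q)"
  proof (rule Bochner_Integration.integrable_bound)
    let ?K = "\<bar>potential s \<rho> 0\<bar> + m"
    have "integrable lborel (\<lambda>y::'a. indicator (cball 0 1) y + tail 1 y)"
      using integrable_tail[of 1] emeasure_lborel_cball_finite[of "0::'a" 1] by (intro Bochner_Integration.integrable_add) (auto simp: integrable_indicator_iff)
    then show "integrable lborel (\<lambda>y::'a. ?K * (indicator (cball 0 1) y + tail 1 y))" by simp
    show "AE y in lborel. norm (- potential s \<rho> (y \<bullet> e) / (1 + norm y) powr ?q) \<le> norm (?K * (indicator (cball 0 1) y + tail 1 y))"
    proof (rule AE_I2)
      fix y :: 'a
      have "\<bar>potential s \<rho> (y \<bullet> e)\<bar> \<le> \<bar>potential s \<rho> 0\<bar> + \<bar>y \<bullet> e\<bar> powr s * m"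
        using Holder[of "y \<bullet> e" 0] by simp
      also have "\<dots> \<le> \<bar>potential s \<rho> 0\<bar> * (1 + norm y) powr s + (1 + norm y) powr s * m"
      proof -
        have "\<bar>y \<bullet> e\<bar> powr s \<le> (1 + norm y) powr s"
          using abs_inner_e[of y] s by (intro powr_mono2) auto
        moreover have "1 \<le> (1 + norm y) powr s"
          using s by (simp add: ge_one_powr_ge_zero)
        ultimately show ?thesis
          using m by (intro add_mono mult_right_mono) (auto simp: mult_le_cancel_left1)
      qed
      finally have "\<bar>potential s \<rho> (y \<bullet> e)\<bar> / (1 + norm y) powr ?q \<le> ?K * (1 + norm y) powr s / (1 + norm y) powr ?q"
        by (intro divide_right_mono) (simp_all add: algebra_simps)
      also have "\<dots> = ?K * (1 + norm y) powr - (real DIM('a) + s)"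
        by (simp add: powr_diff[symmetric] times_divide_eq_right[symmetric] del: times_divide_eq_right)
          (rule disjI2, rule arg_cong[of _ _ "(powr) (1 + norm y)"], simp)
      also have "\<dots> \<le> ?K * (indicator (cball 0 1) y + tail 1 y)"
      proof (intro mult_left_mono)
        show "(1 + norm y) powr - (real DIM('a) + s) \<le> indicator (cball 0 1) y + tail 1 y"
        proof (cases "norm y \<le> 1")
          case True
          have "(1 + norm y) powr - (real DIM('a) + s) \<le> 1 powr - (real DIM('a) + s)"
            using s by (intro powr_mono2') auto
          then show ?thesis using True by (auto simp: indicator_def)
        next
          case False
          then show ?thesis using s by (auto simp: indicator_def intro!: powr_mono2')
        qed
      qed (use m in simp)
      finally show "norm (- potential s \<rho> (y \<bullet> e) / (1 + norm y) powr ?q) \<le> norm (?K * (indicator (cball 0 1) y + tail 1 y))"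
        using m by (simp add: abs_mult)
    qed
  qed simp
  \<comment> \<open>For fixed r > 0 the double integrand is dominated by
    \<open>tail r z * \<rho> t\<close>, so Fubini turns the truncated integral of the average into
    the average of truncated integrals.\<close>
  have truncated: "(LINT y:{y. r < dist x y}|lborel. (- potential s \<rho> (x \<bullet> e) - - potential s \<rho> (y \<bullet> e)) / norm (x - y) powr ?q)
    = (\<integral>t. \<rho> t * trunc r (x \<bullet> e - t) \<partial>lborel)" if r: "0 < r" for r
  proof -
    define g where "g z t = \<rho> t * (indicator {z. r < norm z} z * ((pos_powr s (x \<bullet> e - t + z \<bullet> e) - pos_powr s (x \<bullet> e - t)) * kernel z))" for z t
    have [measurable]: "(\<lambda>(z, t). g z t) \<in> borel_measurable (lborel \<Otimes>\<^sub>M lborel)"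
      unfolding g_def split_beta' by measurable
    have kern: "kernel z = 1 / norm z powr ?q" for z
      unfolding kernel_def by (rule powr_minus_divide)
    have ig: "integrable (lborel \<Otimes>\<^sub>M lborel) (\<lambda>(z, t). g z t)"
    proof (rule Bochner_Integration.integrable_bound)
      have "integrable (lborel \<Otimes>\<^sub>M lborel) (\<lambda>(z, t). tail r z *\<^sub>R \<rho> t)"
      proof (rule lborel_pair.Fubini_integrable)
        show "integrable lborel (\<lambda>z. \<integral>t. norm (case (z, t) of (z, t) \<Rightarrow> tail r z *\<^sub>R \<rho> t) \<partial>lborel)"
          using integrable_tail[OF r] by (simp add: abs_mult)
      qed (use i\<rho> in auto)
      then show "integrable (lborel \<Otimes>\<^sub>M lborel) (\<lambda>(z, t). tail r z * \<rho> t)" by simp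
      have "\<bar>g z t\<bar> \<le> \<bar>tail r z * \<rho> t\<bar>" for z t
      proof -
        have "\<bar>indicator {z. r < norm z} z * ((pos_powr s (x \<bullet> e - t + z \<bullet> e) - pos_powr s (x \<bullet> e - t)) * kernel z)\<bar> \<le> tail r z"
          using increment_bound[of "x \<bullet> e - t" z] by (auto simp: indicator_def)
        from mult_left_mono[OF this \<rho>(2)[of t]] show ?thesis
          using \<rho>(2)[of t] by (simp add: g_def abs_mult mult.commute)
      qed
      then show "AE p in lborel \<Otimes>\<^sub>M lborel. norm (case p of (z, t) \<Rightarrow> g z t) \<le> norm (case p of (z, t) \<Rightarrow> tail r z * \<rho> t)"
        by (intro AE_I2) auto
    qed simp
    have "(LINT y:{y. r < dist x y}|lborel. (- potential s \<rho> (x \<bullet> e) - - potential s \<rho> (y \<bullet> e)) / norm (x - y) powr ?q)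
      = (\<integral>z. indicator {y. r < dist x y} (x + 1 *\<^sub>R z) *\<^sub>R ((- potential s \<rho> (x \<bullet> e) - - potential s \<rho> ((x + 1 *\<^sub>R z) \<bullet> e)) / norm (x - (x + 1 *\<^sub>R z)) powr ?q) \<partial>lborel)"
      unfolding set_lebesgue_integral_def
      by (subst integral_lborel_affine[of 1 _ x]) auto
    also have "\<dots> = (\<integral>z. indicator {z. r < norm z} z * ((potential s \<rho> (x \<bullet> e + z \<bullet> e) - potential s \<rho> (x \<bullet> e)) * kernel z) \<partial>lborel)"
      by (intro Bochner_Integration.integral_cong)
        (auto simp: kern dist_norm indicator_def inner_add_left)
    also have "\<dots> = (\<integral>z. (\<integral>t. g z t \<partial>lborel) \<partial>lborel)"
    proof (intro Bochner_Integration.integral_cong refl)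
      fix z
      have "indicator {z. r < norm z} z * ((potential s \<rho> (x \<bullet> e + z \<bullet> e) - potential s \<rho> (x \<bullet> e)) * kernel z)
        = (\<integral>t. (indicator {z. r < norm z} z * kernel z) * (\<rho> t * (pos_powr s (x \<bullet> e + z \<bullet> e - t) - pos_powr s (x \<bullet> e - t))) \<partial>lborel)"
        unfolding pot_diff integral_mult_right_zero by simp
      also have "\<dots> = (\<integral>t. g z t \<partial>lborel)"
        by (intro Bochner_Integration.integral_cong) (auto simp: g_def algebra_simps)
      finally show "indicator {z. r < norm z} z * ((potential s \<rho> (x \<bullet> e + z \<bullet> e) - potential s \<rho> (x \<bullet> e)) * kernel z) = (\<integral>t. g z t \<partial>lborel)" .
    qed
    also have "\<dots> = (\<integral>t. (\<integral>z. g z t \<partial>lborel) \<partial>lborel)"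
      by (rule lborel_pair.Fubini_integral[OF ig, symmetric])
    also have "\<dots> = (\<integral>t. \<rho> t * trunc r (x \<bullet> e - t) \<partial>lborel)"
      unfolding g_def trunc_def integral_mult_right_zero ..
    finally show ?thesis .
  qed
  obtain C where C: "\<And>r y. 0 < r \<Longrightarrow> y \<noteq> 0 \<Longrightarrow> \<bar>trunc r y\<bar> \<le> C * \<bar>y\<bar> powr - s"
    "\<And>y. y \<noteq> 0 \<Longrightarrow> ((\<lambda>r. trunc r y) \<longlongrightarrow> limit y) (at_right 0)"
    using trunc_bound_and_limit by blast
  have "((\<lambda>r. \<integral>t. \<rho> t * trunc r (x \<bullet> e - t) \<partial>lborel) \<longlongrightarrow> (\<integral>t. \<rho> t * limit (x \<bullet> e - t) \<partial>lborel)) (at_right 0)"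
  proof (rule integral_dominated_convergence_at_right)
    show "integrable lborel (\<lambda>t. M * C * (indicator {-1..0} t * \<bar>x \<bullet> e - t\<bar> powr - s))"
      using integrable_abs_powr_interval[OF s] by simp
    \<comment> \<open>The excluded point t = \<open>x \<bullet> e\<close> is the one where the
      translated profile has its kink at \<open>x\<close>.\<close>
    show "AE t in lborel. ((\<lambda>r. \<rho> t * trunc r (x \<bullet> e - t)) \<longlongrightarrow> \<rho> t * limit (x \<bullet> e - t)) (at_right 0)"
      using AE_lborel_singleton[of "x \<bullet> e"] by eventually_elim (auto intro!: tendsto_intros C)
    show "AE t in lborel. norm (\<rho> t * trunc r (x \<bullet> e - t)) \<le> M * C * (indicator {-1..0} t * \<bar>x \<bullet> e - t\<bar> powr - s)"
      if r: "0 < r" for r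
      using AE_lborel_singleton[of "x \<bullet> e"]
    proof eventually_elim
      case (elim t)
      have "norm (\<rho> t * trunc r (x \<bullet> e - t)) = \<rho> t * \<bar>trunc r (x \<bullet> e - t)\<bar>"
        using \<rho>(2) by (simp add: abs_mult)
      also have "\<dots> \<le> (M * indicator {-1..0} t) * (C * \<bar>x \<bullet> e - t\<bar> powr - s)"
        using \<rho>M[of t] C(1)[OF r, of "x \<bullet> e - t"] elim \<rho>(2)[of t] M(1) by (intro mult_mono) auto
      finally show ?case by (simp add: mult_ac)
    qed
  qed auto
  then have "((\<lambda>r. frac_laplacian_const DIM('a) s * (\<integral>t. \<rho> t * trunc r (x \<bullet> e - t) \<partial>lborel))
     \<longlongrightarrow> frac_laplacian_const DIM('a) s * (\<integral>t. \<rho> t * limit (x \<bullet> e - t) \<partial>lborel)) (at_right 0)"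
    by (intro tendsto_intros)
  then have "((\<lambda>r. frac_laplacian_const DIM('a) s * (LINT y:{y. r < dist x y}|lborel.
      (- potential s \<rho> (x \<bullet> e) - - potential s \<rho> (y \<bullet> e)) / norm (x - y) powr ?q))
     \<longlongrightarrow> frac_laplacian_const DIM('a) s * (\<integral>t. \<rho> t * limit (x \<bullet> e - t) \<partial>lborel)) (at_right 0)"
    by (rule Lim_transform_eventually) (use truncated in \<open>auto simp: eventually_at_filter\<close>)
  then show ?thesis
    using weight unfolding has_frac_laplacian_def by simp
qed

lemma frac_laplacian_const_nonneg: "0 \<le> frac_laplacian_const n s"
proof -
  have "Gamma (real n / 2 + s) > 0" using s by (intro Gamma_real_pos) auto
  then show ?thesis by (simp add: frac_laplacian_const_def)
qed

text \<open>Placing the support of \<rho> in [-1, 0] makes \<open>x \<bullet> e - t\<close> at least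
  \<open>x \<bullet> e\<close>, so a point with nonnegative coordinate meets only arguments where
  \<open>limit\<close> is 0. The description operator is resolved by uniqueness of limits.\<close>

lemma frac_laplacian_potential:
  assumes \<rho>: "continuous_on UNIV \<rho>" "\<And>t. 0 \<le> \<rho> t" "\<And>t. t \<notin> {-1..0} \<Longrightarrow> \<rho> t = 0"
  defines "u \<equiv> \<lambda>x::'a. - potential s \<rho> (x \<bullet> e)"
  shows "frac_laplacian_exists s u x" "0 \<le> frac_laplacian s u x"
    "0 \<le> x \<bullet> e \<Longrightarrow> frac_laplacian s u x = 0"
proof -
  let ?L = "frac_laplacian_const DIM('a) s * (\<integral>t. \<rho> t * limit (x \<bullet> e - t) \<partial>lborel)"
  have L: "has_frac_laplacian s u ?L x"
    unfolding u_def by (rule has_frac_laplacian_potential[OF \<rho>])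
  then show "frac_laplacian_exists s u x" unfolding frac_laplacian_exists_def by blast
  have eq: "frac_laplacian s u x = ?L"
    unfolding frac_laplacian_def
  proof (rule the_equality[of _ ?L])
    show "L = ?L" if "has_frac_laplacian s u L x" for L
      using that L tendsto_unique[OF trivial_limit_at_right_real]
      unfolding has_frac_laplacian_def by blast
  qed (rule L)
  show "0 \<le> frac_laplacian s u x"
    unfolding eq using \<rho>(2) limit_nonneg frac_laplacian_const_nonneg
    by (intro mult_nonneg_nonneg integral_nonneg_AE AE_I2) auto
  show "frac_laplacian s u x = 0" if "0 \<le> x \<bullet> e"
  proof -
    have "(\<lambda>t. \<rho> t * limit (x \<bullet> e - t)) = (\<lambda>_. 0)"
    proof
      fix t
      show "\<rho> t * limit (x \<bullet> e - t) = 0"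
        using \<rho>(3)[of t] that by (cases "t \<in> {-1..0}") (auto simp: limit_def)
    qed
    then show ?thesis unfolding eq by simp
  qed
qed

end

section \<open>Smoothness of the potential\<close>

text \<open>\<open>pos_powr s\<close> is not differentiable at 0, so the variables in the
  convolution are exchanged first and the derivative falls on \<rho>. Near \<open>x0\<close> the
  integral then runs over a fixed compact interval, where the Leibniz rule applies.\<close>

lemma potential_has_real_derivative:
  assumes s: "0 < s"
    and \<rho>: "\<And>t. (\<rho> has_real_derivative \<rho>' t) (at t)" "continuous_on UNIV \<rho>'"
    and supp: "\<And>t. t \<notin> {-1..0} \<Longrightarrow> \<rho> t = 0" "\<And>t. t \<notin> {-1..0} \<Longrightarrow> \<rho>' t = 0"
  shows "(potential s \<rho> has_real_derivative potential s \<rho>' x0) (at x0)"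
proof -
  \<comment> \<open>If |x - x0| < 1 and t > N, then x - t < -1 lies outside the support.\<close>
  define N where "N = \<bar>x0\<bar> + 2"
  have c\<rho>: "continuous_on UNIV \<rho>"
    using \<rho>(1) by (auto intro!: continuous_at_imp_continuous_on intro: DERIV_isCont)
  have eq: "potential s f x = integral (cbox 0 N) (\<lambda>t. f (x - t) * pos_powr s t)"
    if f: "continuous_on UNIV f" "\<And>t. t \<notin> {-1..0} \<Longrightarrow> f t = 0" and x: "x \<in> ball x0 1" for f x
  proof -
    have [measurable]: "f \<in> borel_measurable borel" by (rule borel_measurable_continuous_onI[OF f(1)])
    have "potential s f x = (\<integral>t. f (x + (-1) *\<^sub>R t) * pos_powr s (x - (x + (-1) *\<^sub>R t)) \<partial>lborel)"
      unfolding potential_def by (subst integral_lborel_affine[of "-1" _ x]) auto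
    also have "\<dots> = (\<integral>t. indicator {0..N} t *\<^sub>R (f (x - t) * pos_powr s t) \<partial>lborel)"
    proof (intro Bochner_Integration.integral_cong refl)
      fix t
      have "f (x - t) = 0" if "t > N"
        using that x by (intro f(2)) (auto simp: N_def dist_real_def)
      then show "f (x + (-1) *\<^sub>R t) * pos_powr s (x - (x + (-1) *\<^sub>R t)) = indicator {0..N} t *\<^sub>R (f (x - t) * pos_powr s t)"
        by (cases "t < 0"; cases "t > N") (auto simp: indicator_def pos_powr_eq_0)
    qed
    also have "\<dots> = integral {0..N} (\<lambda>t. f (x - t) * pos_powr s t)"
    proof -
      have "continuous_on {0..N} (\<lambda>t. f (x - t) * pos_powr s t)"
        using s by (intro continuous_intros continuous_on_compose2[OF f(1)]) auto
      then have "set_integrable lborel {0..N} (\<lambda>t. f (x - t) * pos_powr s t)"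
        by (rule borel_integrable_atLeastAtMost')
      from set_borel_integral_eq_integral(2)[OF this] show ?thesis
        by (simp add: set_lebesgue_integral_def)
    qed
    finally show ?thesis by simp
  qed
  have "((\<lambda>x. integral (cbox 0 N) (\<lambda>t. \<rho> (x - t) * pos_powr s t)) has_real_derivative
    integral (cbox 0 N) (\<lambda>t. \<rho>' (x0 - t) * pos_powr s t)) (at x0 within ball x0 1)"
  proof (rule leibniz_rule_field_derivative)
    show "((\<lambda>x. \<rho> (x - t) * pos_powr s t) has_real_derivative \<rho>' (x - t) * pos_powr s t) (at x within ball x0 1)" for x t
    proof (rule DERIV_cmult_right)
      have "((\<lambda>x. \<rho> (x - t)) has_real_derivative \<rho>' (x - t)) (at x)"
        using DERIV_chain2[OF \<rho>(1) DERIV_diff[OF DERIV_ident DERIV_const]] by simp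
      then show "((\<lambda>x. \<rho> (x - t)) has_real_derivative \<rho>' (x - t)) (at x within ball x0 1)"
        by (rule has_field_derivative_at_within)
    qed
    show "(\<lambda>t. \<rho> (x - t) * pos_powr s t) integrable_on cbox 0 N" for x
      using s by (intro integrable_continuous continuous_intros continuous_on_compose2[OF c\<rho>]) auto
    show "continuous_on (ball x0 1 \<times> cbox 0 N) (\<lambda>(x, t). \<rho>' (x - t) * pos_powr s t)"
      using s unfolding split_beta by (intro continuous_intros continuous_on_compose2[OF \<rho>(2)]) auto
  qed auto
  then have "((\<lambda>x. integral (cbox 0 N) (\<lambda>t. \<rho> (x - t) * pos_powr s t)) has_real_derivative potential s \<rho>' x0) (at x0)"
    using eq[OF \<rho>(2) supp(2), of x0] by (simp add: at_within_open[of x0 "ball x0 1"])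
  then show ?thesis
    by (rule has_field_derivative_transform_within_open[of _ _ _ "ball x0 1"])
      (use eq[OF c\<rho> supp(1)] in auto)
qed

lemma smooth_real_potential:
  assumes "0 < s" "smooth_real \<rho>" "\<And>t. t \<notin> {-1..0} \<Longrightarrow> \<rho> t = 0"
  shows "smooth_real (potential s \<rho>)"
proof -
  obtain D where D: "D 0 = \<rho>" "\<And>k x. (D k has_real_derivative D (Suc k) x) (at x)"
    using smooth_realE[OF assms(2)] by blast
  have 0: "D k x = 0" if "x \<notin> {-1..0}" for k x
    by (rule derivatives_eq_0_outside[of D "-1" 0]) (use D assms(3) that in auto)
  have "smooth_real ((\<lambda>k. potential s (D k)) 0)"
  proof (rule smooth_realI)
    fix k x
    have "continuous_on UNIV (D (Suc k))"
      using D(2) by (auto intro!: continuous_at_imp_continuous_on intro: DERIV_isCont)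
    then show "(potential s (D k) has_real_derivative potential s (D (Suc k)) x) (at x)"
      by (intro potential_has_real_derivative assms(1) D(2) 0)
  qed
  then show ?thesis by (simp add: D(1))
qed

lemma potential_not_constant:
  assumes s: "0 < s" and \<rho>: "continuous_on UNIV \<rho>" "\<And>t. 0 \<le> \<rho> t" "\<And>t. t \<notin> {-1..0} \<Longrightarrow> \<rho> t = 0"
    and pos: "0 < \<rho> (- (1/2))"
  shows "potential s \<rho> (-1) = 0" "0 < potential s \<rho> 0"
proof -
  have "(\<lambda>t. \<rho> t * pos_powr s (-1 - t)) = (\<lambda>_. 0)"
  proof
    fix t show "\<rho> t * pos_powr s (-1 - t) = 0"
      using \<rho>(3)[of t] by (cases "t \<in> {-1..0}") (auto simp: pos_powr_eq_0)
  qed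
  then show "potential s \<rho> (-1) = 0" unfolding potential_def by simp
  let ?f = "\<lambda>t. \<rho> t * pos_powr s (0 - t)"
  have cf: "continuous_on {-1..0} ?f"
    using s by (intro continuous_intros continuous_on_subset[OF \<rho>(1)]) auto
  have "potential s \<rho> 0 = (LINT t:{-1..0}|lborel. ?f t)"
    unfolding potential_def set_lebesgue_integral_def
    by (intro Bochner_Integration.integral_cong) (use \<rho>(3) in \<open>auto simp: indicator_def\<close>)
  also have "\<dots> = integral {-1..0} ?f"
    by (rule set_borel_integral_eq_integral(2)[OF borel_integrable_atLeastAtMost'[OF cf]])
  also have "\<dots> > 0"
  proof -
    have "integral {-1..0} ?f \<noteq> 0"
    proof
      assume "integral {-1..0} ?f = 0"
      then have "\<forall>t\<in>{-1..0}. ?f t = 0"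
        using cf \<rho>(2) by (subst (asm) integral_eq_0_iff) auto
      then show False using pos by (auto simp: pos_powr_def dest: bspec[of _ _ "- (1/2)"])
    qed
    moreover have "integral {-1..0} ?f \<ge> 0"
      using \<rho>(2) by (intro Henstock_Kurzweil_Integration.integral_nonneg integrable_continuous_interval cf) auto
    ultimately show ?thesis by simp
  qed
  finally show "0 < potential s \<rho> 0" .
qed

section \<open>Hausdorff dimension of sets of positive measure\<close>

text \<open>A nonempty bounded set lies in the ball about any of its points with radius its
  diameter. For diameters at most 1 and d < n, diam^n \<le> diam^d, so the Lebesgue measure is at
  most V times the content at scale 1.\<close>

lemma null_set_if_hausdorff_measure_0:
  fixes A :: "'a::euclidean_space set"
  assumes A: "A \<in> sets borel" and d: "0 \<le> d" "d < real DIM('a)" and H: "hausdorff_measure d A = 0"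
  shows "emeasure lborel A = 0"
proof -
  define V where "V = unit_ball_vol (real DIM('a))"
  have "hausdorff_content d 1 A \<le> hausdorff_measure d A"
    unfolding hausdorff_measure_def by (rule SUP_upper) auto
  then have content: "hausdorff_content d 1 A = 0" using H by simp
  have "emeasure lborel A \<le> ennreal V * c" if "0 < c" for c
  proof -
    obtain U :: "nat \<Rightarrow> 'a set" where U: "A \<subseteq> (\<Union>i. U i)" "\<And>i. bounded (U i)" "\<And>i. diameter (U i) \<le> 1"
      "(\<Sum>i. hausdorff_weight d (U i)) < c"
    proof -
      have "hausdorff_content d 1 A < c" using content \<open>0 < c\<close> by simp
      then obtain U where "U \<in> {U :: nat \<Rightarrow> 'a set. A \<subseteq> (\<Union>i. U i) \<and> (\<forall>i. bounded (U i) \<and> diameter (U i) \<le> 1)}"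
        "(\<Sum>i. hausdorff_weight d (U i)) < c"
        unfolding hausdorff_content_def INF_less_iff by blast
      then show ?thesis using that[of U] by blast
    qed
    have "\<exists>B. B \<in> sets borel \<and> U i \<subseteq> B \<and> emeasure lborel B \<le> ennreal V * hausdorff_weight d (U i)" for i
    proof (cases "U i = {}")
      case False
      then obtain x where x: "x \<in> U i" by blast
      let ?B = "cball x (diameter (U i))"
      have diam: "0 \<le> diameter (U i)" by (rule diameter_ge_0[OF U(2)])
      have "U i \<subseteq> ?B"
        using diameter_bounded_bound[OF U(2) x] by auto
      moreover have "emeasure lborel ?B \<le> ennreal V * hausdorff_weight d (U i)"
      proof -
        have "emeasure lborel ?B = ennreal V * ennreal (diameter (U i) ^ DIM('a))"
          using diam unfolding V_def by (subst emeasure_cball) (auto simp: ennreal_mult)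
        also have "\<dots> \<le> ennreal V * hausdorff_weight d (U i)"
        proof (intro mult_left_mono)
          \<comment> \<open>For d = 0 the weight of a nonempty set is 1 by definition and needs its
            own comparison.\<close>
          show "ennreal (diameter (U i) ^ DIM('a)) \<le> hausdorff_weight d (U i)"
          proof (cases "d = 0")
            case True
            then show ?thesis
              using False diam U(3)[of i] by (simp add: hausdorff_weight_def power_le_one)
          next
            case d0: False
            have "diameter (U i) ^ DIM('a) \<le> diameter (U i) powr d"
            proof (cases "diameter (U i) = 0")
              case False
              then have "diameter (U i) ^ DIM('a) = diameter (U i) powr real DIM('a)"
                using diam by (simp add: powr_realpow)
              also have "\<dots> \<le> diameter (U i) powr d"
                using d diam U(3)[of i] by (intro powr_mono') auto
              finally show ?thesis .
            qed (simp add: zero_power)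
            then show ?thesis
              using False d0 by (simp add: hausdorff_weight_def ennreal_leI)
          qed
        qed simp
        finally show ?thesis .
      qed
      ultimately show ?thesis by (intro exI[of _ ?B]) auto
    qed (auto intro!: exI[of _ "{}"])
    then obtain B where B: "\<And>i. B i \<in> sets borel" "\<And>i. U i \<subseteq> B i"
      "\<And>i. emeasure lborel (B i) \<le> ennreal V * hausdorff_weight d (U i)"
      by metis
    have "emeasure lborel A \<le> emeasure lborel (\<Union>i. B i)"
      using U(1) B(1,2) by (intro emeasure_mono) (auto, blast)
    also have "\<dots> \<le> (\<Sum>i. emeasure lborel (B i))"
      using B(1) by (intro emeasure_subadditive_countably) auto
    also have "\<dots> \<le> (\<Sum>i. ennreal V * hausdorff_weight d (U i))"
      using B(3) by (intro suminf_le) auto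
    also have "\<dots> = ennreal V * (\<Sum>i. hausdorff_weight d (U i))" by simp
    also have "\<dots> \<le> ennreal V * c"
      using U(4) by (intro mult_left_mono) auto
    finally show ?thesis .
  qed
  note le = this
  have V: "V > 0" unfolding V_def by simp
  have "emeasure lborel A \<le> ennreal c" if "0 < c" for c
  proof -
    have "ennreal V * ennreal (c / V) = ennreal c"
      using V by (subst ennreal_mult'[symmetric]) auto
    moreover have "0 < ennreal (c / V)" using V that by simp
    ultimately show ?thesis
      using le[of "ennreal (c / V)"] by metis
  qed
  then have "emeasure lborel A \<le> 0 + ennreal c" if "0 < c" for c using that by simp
  then have "emeasure lborel A \<le> 0"
    by (rule ennreal_le_epsilon)
  then show ?thesis by simp
qed

lemma hausdorff_dim_ge:
  fixes A :: "'a::euclidean_space set"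
  assumes "A \<in> sets borel" and "emeasure lborel A \<noteq> 0"
  shows "hausdorff_dim A \<ge> ereal (real DIM('a))"
  unfolding hausdorff_dim_def
proof (rule Inf_greatest)
  fix x assume "x \<in> ereal ` {d. 0 \<le> d \<and> hausdorff_measure d A = 0}"
  then obtain d where "x = ereal d" "0 \<le> d" "hausdorff_measure d A = 0" by auto
  then show "ereal (real DIM('a)) \<le> x"
    using null_set_if_hausdorff_measure_0[OF assms(1), of d] assms(2) by force
qed

section \<open>The obstacle problem\<close>

lemma emeasure_slab:
  fixes i :: "'n::finite"
  assumes "a \<le> b"
  shows "emeasure lborel (cbox (\<chi> j. if j = i then a else 1) (\<chi> j. if j = i then b else 2) :: (real ^ 'n) set) = ennreal (b - a)"
proof -
  let ?B = "cbox (\<chi> j. if j = i then a else 1) (\<chi> j. if j = i then b else 2) :: (real ^ 'n) set"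
  have ne: "?B \<noteq> {}"
    using assms by (auto simp: interval_ne_empty_cart)
  have "emeasure lborel ?B = ennreal (measure lborel ?B)"
    using emeasure_lborel_cbox_finite by (intro emeasure_eq_ennreal_measure) (simp add: less_top)
  also have "measure lborel ?B = (\<Prod>j\<in>UNIV. if j = i then b - a else 1)"
    unfolding content_cbox_cart[OF ne] by (intro prod.cong) auto
  finally show ?thesis by (simp add: prod.delta)
qed

text \<open>The k-th interval has length (1/2)^(k+2), so all together they have length at most 1/2.
  Their slabs over a unit cross-section cannot cover a unit cube.\<close>

lemma emeasure_avoiding_slabs:
  fixes i :: "'n::finite" and q :: "nat \<Rightarrow> real"
  defines "G \<equiv> (\<Union>k. {q k - (1/2) ^ (k + 3)<..<q k + (1/2) ^ (k + 3)})"
  shows "emeasure lborel {x::real ^ 'n. 0 < x $ i \<and> x $ i \<notin> G} \<noteq> 0"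
proof
  let ?S = "{x::real ^ 'n. 0 < x $ i \<and> x $ i \<notin> G}"
  define B where "B k = (cbox (\<chi> j. if j = i then q k - (1/2) ^ (k + 3) else 1)
    (\<chi> j. if j = i then q k + (1/2) ^ (k + 3) else 2) :: (real ^ 'n) set)" for k
  \<comment> \<open>The cube [1, 2]^n lies where the coordinate is positive; the trivial
    conditionals bring it into the form measured by \<open>emeasure_slab\<close>.\<close>
  let ?Q = "cbox (\<chi> j. if j = i then 1 else 1) (\<chi> j. if j = i then 2 else 2) :: (real ^ 'n) set"
  have "open G" unfolding G_def by auto
  moreover have "(\<lambda>x::real ^ 'n. x $ i) \<in> borel_measurable borel"
    by (intro borel_measurable_continuous_onI continuous_intros)
  ultimately have "(\<lambda>x::real ^ 'n. x $ i) -` ({0<..} - G) \<inter> space borel \<in> sets borel"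
    by (intro measurable_sets[of _ _ borel]) auto
  also have "(\<lambda>x::real ^ 'n. x $ i) -` ({0<..} - G) \<inter> space borel = ?S" by auto
  finally have mS: "?S \<in> sets borel" .
  assume S: "emeasure lborel ?S = 0"
  have sub: "?Q \<subseteq> ?S \<union> (\<Union>k. B k)"
  proof
    fix x assume x: "x \<in> ?Q"
    then have x1: "1 \<le> x $ j" "x $ j \<le> 2" for j by (auto simp: mem_box_cart)
    show "x \<in> ?S \<union> (\<Union>k. B k)"
    proof (cases "x $ i \<in> G")
      case True
      then obtain k where "x $ i \<in> {q k - (1/2) ^ (k + 3)<..<q k + (1/2) ^ (k + 3)}" unfolding G_def by blast
      then have "x \<in> B k" using x1 by (auto simp: B_def mem_box_cart)
      then show ?thesis by blast
    next
      case False
      then show ?thesis using x1[of i] by auto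
    qed
  qed
  have B: "emeasure lborel (B k) = ennreal ((1/2) ^ (k + 2))" for k
    unfolding B_def by (subst emeasure_slab) (auto simp: power_add power_divide)
  have "ennreal 1 = emeasure lborel ?Q"
    by (subst emeasure_slab) auto
  also have "\<dots> \<le> emeasure lborel (?S \<union> (\<Union>k. B k))"
    using sub mS by (intro emeasure_mono) (auto simp: B_def)
  also have "\<dots> \<le> emeasure lborel ?S + emeasure lborel (\<Union>k. B k)"
    using mS by (intro emeasure_subadditive) (auto simp: B_def)
  also have "\<dots> \<le> 0 + (\<Sum>k. emeasure lborel (B k))"
    unfolding S by (intro add_left_mono emeasure_subadditive_countably) (auto simp: B_def)
  also have "\<dots> = (\<Sum>k. ennreal ((1/4) * (1/2) ^ k))"
    by (simp add: B power_add mult.commute)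
  also have "\<dots> = ennreal (\<Sum>k. (1/4) * (1/2) ^ k)"
    by (intro suminf_ennreal2 summable_mult summable_geometric) auto
  also have "(\<Sum>k. (1/4) * (1/2 :: real) ^ k) = 1/2"
    by (subst suminf_mult) (auto simp: suminf_geometric summable_geometric)
  finally show False by (subst (asm) ennreal_le_iff) auto
qed

theorem proposition1p9:
  fixes s \<epsilon> :: real
  assumes "CARD('n::finite) \<ge> 2" and "0 < s" and "s < 1" and "\<epsilon> > 0"
  shows "\<exists>(u :: real ^ 'n \<Rightarrow> real) (\<phi> :: real ^ 'n \<Rightarrow> real).
           \<not> u constant_on UNIV \<and> C_infinity \<phi> \<and> frac_obstacle_solution s \<phi> u \<and>
           hausdorff_dim (frontier (contact_set \<phi> u)) \<ge> ereal (real CARD('n) - \<epsilon>)"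
proof -
  define i :: 'n where "i = undefined"
  interpret frac_kernel s "axis i 1 :: real ^ 'n"
    by standard (use assms in \<open>auto simp: axis_in_Basis_iff\<close>)
  \<comment> \<open>Positive exactly on (-1, 0), in particular at -1/2, which makes the potential
    non-constant.\<close>
  define \<rho> where "\<rho> t = flat_exp (- t) * flat_exp (t + 1)" for t
  have smooth_\<rho>: "smooth_real \<rho>"
    unfolding \<rho>_def using smooth_real_mult[OF smooth_real_affine[of flat_exp "-1" 0] smooth_real_affine[of flat_exp 1 1]]
      smooth_flat_exp by simp
  have \<rho>: "continuous_on UNIV \<rho>" "\<And>t. 0 \<le> \<rho> t" "\<And>t. t \<notin> {-1..0} \<Longrightarrow> \<rho> t = 0" "0 < \<rho> (- (1/2))"
    by (auto intro: smooth_real_continuous[OF smooth_\<rho>]) (auto simp: \<rho>_def flat_exp_def)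
  have smooth_potential: "smooth_real (potential s \<rho>)"
    by (rule smooth_real_potential[OF assms(2) smooth_\<rho> \<rho>(3)])
  define q where "q = from_nat_into (\<rat> :: real set)"
  have range_q: "range q = \<rat>"
    unfolding q_def by (intro range_from_nat_into countable_rat) auto
  define G where "G = (\<Union>k. {q k - (1/2) ^ (k + 3)<..<q k + (1/2) ^ (k + 3)})"
  obtain \<eta>\<^sub>0 where \<eta>\<^sub>0: "smooth_real \<eta>\<^sub>0" "\<And>x. \<eta>\<^sub>0 x \<ge> 0" "\<And>x. \<eta>\<^sub>0 x = 0 \<longleftrightarrow> x \<notin> G"
    unfolding G_def
    using smooth_function_of_open_Union[of "\<lambda>k. q k - (1/2) ^ (k + 3)" "\<lambda>k. q k + (1/2) ^ (k + 3)"]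
    by blast
  \<comment> \<open>The factor \<open>flat_exp x\<close> switches \<eta> off for x \<le> 0 and adds
    no zeros for x > 0, so strict inequality \<open>u > \<phi>\<close> occurs only where the
    equation is known.\<close>
  define \<eta> where "\<eta> x = flat_exp x * \<eta>\<^sub>0 x" for x
  have smooth_\<eta>: "smooth_real \<eta>"
    unfolding \<eta>_def by (intro smooth_real_mult smooth_flat_exp \<eta>\<^sub>0(1))
  have \<eta>: "\<eta> x \<ge> 0" "\<eta> x = 0 \<longleftrightarrow> x \<le> 0 \<or> x \<notin> G" for x
    using \<eta>\<^sub>0(2,3) by (auto simp: \<eta>_def flat_exp_def)
  define u where "u x = - potential s \<rho> (x $ i)" for x :: "real ^ 'n"
  define \<phi> where "\<phi> x = - potential s \<rho> (x $ i) - \<eta> (x $ i)" for x :: "real ^ 'n"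
  have u: "u = (\<lambda>x. - potential s \<rho> (x \<bullet> axis i 1))"
    by (simp add: u_def fun_eq_iff inner_axis)
  have cont_u: "continuous_on UNIV u"
    unfolding u_def
    by (intro continuous_intros continuous_on_compose2[OF smooth_real_continuous[OF smooth_potential, of UNIV]]) auto
  have "\<not> u constant_on UNIV"
  proof
    assume "u constant_on UNIV"
    then have "u (\<chi> j. - 1) = u 0" unfolding constant_on_def by auto
    then show False
      using potential_not_constant[OF assms(2) \<rho>] by (simp add: u_def)
  qed
  moreover have "C_infinity \<phi>"
    unfolding \<phi>_def
    by (rule C_infinity_component[of "\<lambda>x. - potential s \<rho> x - \<eta> x"])
      (intro smooth_real_diff smooth_real_uminus smooth_potential smooth_\<eta>)
  moreover have "frac_obstacle_solution s \<phi> u"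
    unfolding frac_obstacle_solution_def
  proof (intro conjI allI ballI)
    fix x
    show "frac_laplacian_exists s u x" "0 \<le> frac_laplacian s u x"
      unfolding u using frac_laplacian_potential(1,2)[OF \<rho>(1-3)] by blast+
    show "\<phi> x \<le> u x"
      using \<eta>(1) by (simp add: u_def \<phi>_def)
  next
    fix x assume "x \<in> {x. \<phi> x < u x}"
    then have "\<eta> (x $ i) \<noteq> 0" by (auto simp: u_def \<phi>_def)
    then have "0 \<le> x $ i" using \<eta>(2) by force
    then have "0 \<le> x \<bullet> axis i 1" by (simp add: inner_axis)
    then show "frac_laplacian s u x = 0"
      unfolding u using frac_laplacian_potential(3)[OF \<rho>(1-3)] by blast
  qed (rule cont_u)
  moreover have "ereal (real CARD('n) - \<epsilon>) \<le> hausdorff_dim (frontier (contact_set \<phi> u))"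
  proof -
    have contact: "contact_set \<phi> u = {x. x $ i \<le> 0 \<or> x $ i \<notin> G}"
      using \<eta>(2) by (auto simp: contact_set_def u_def \<phi>_def)
    let ?S = "{x::real ^ 'n. 0 < x $ i \<and> x $ i \<notin> G}"
    have sub: "?S \<subseteq> frontier (contact_set \<phi> u)"
    proof
      fix x assume x: "x \<in> ?S"
      have "x \<notin> interior (contact_set \<phi> u)"
      proof
        assume "x \<in> interior (contact_set \<phi> u)"
        then obtain r where r: "r > 0" "ball x r \<subseteq> contact_set \<phi> u"
          by (auto simp: mem_interior)
        \<comment> \<open>Moving \<open>x\<close> along its i-th axis to a slightly larger rational
          coordinate stays in the ball but enters \<open>G\<close> with positive coordinate, hence
          leaves the contact set.\<close>
        obtain p where p: "p \<in> \<rat>" "x $ i < p" "p < x $ i + r"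
          using Rats_dense_in_real[of "x $ i" "x $ i + r"] r(1) by auto
        define y where "y = x + (p - x $ i) *\<^sub>R axis i 1"
        have "y $ i = p" by (simp add: y_def)
        have "y \<in> ball x r"
          using p by (simp add: y_def dist_norm)
        then have "p \<le> 0 \<or> p \<notin> G"
          using r(2) \<open>y $ i = p\<close> unfolding contact by blast
        moreover have "p \<in> G"
        proof -
          obtain k where "p = q k" using p(1) range_q by blast
          then show ?thesis unfolding G_def by (intro UN_I[of k]) auto
        qed
        moreover have "0 < p" using p x by simp
        ultimately show False by simp
      qed
      moreover have "x \<in> contact_set \<phi> u" using x unfolding contact by simp
      ultimately show "x \<in> frontier (contact_set \<phi> u)"
        by (simp add: frontier_def closure_subset[THEN subsetD])
    qed
    have "emeasure lborel (frontier (contact_set \<phi> u)) \<noteq> 0"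
    proof
      assume "emeasure lborel (frontier (contact_set \<phi> u)) = 0"
      then have "emeasure lborel ?S = 0"
        using emeasure_mono[OF sub, of lborel] by simp
      then show False
        using emeasure_avoiding_slabs[of i q] unfolding G_def by simp
    qed
    then have "ereal (real DIM(real ^ 'n)) \<le> hausdorff_dim (frontier (contact_set \<phi> u))"
      by (intro hausdorff_dim_ge) simp_all
    then show ?thesis
      using assms(4) by (simp add: order_trans[rotated])
  qed
  ultimately show ?thesis by blast
qed

end
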